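(* Let $M$ be an $m$-dimensional closed manifold $(m\geq 1)$, and let $i : M\rightarrow \mathbb{R}^\ell$ $(m+1\leq \ell)$ be an immersion with normal crossings. Then there exist $p_1,\ldots,p_{m+1}\in i(M)$ and $p_{m+2},\ldots,p_\ell\in \mathbb{R}^\ell$ such that $D_{(p_1,\ldots,p_\ell)}\circ i : M\rightarrow \mathbb{R}^\ell$ is an immersion with normal crossings.
   Context: All manifolds and mappings are of class $C^\infty$. A closed manifold is a compact manifold without boundary. $d(x,y)=\sqrt{\sum_{j=1}^n(x_j-y_j)^2}$ is the Euclidean distance on $\mathbb{R}^n$. For points $p_1,\ldots,p_\ell\in\mathbb{R}^n$ ($\ell\ge1$), the distance-squared mapping $D_{(p_1,\ldots,p_\ell)}:\mathbb{R}^n\to\mathbb{R}^\ell$ is defined by $D_{(p_1,\ldots,p_\ell)}(x)=(d^2(p_1,x),\ldots,d^2(p_\ell,x))$, where $d^2(p,x)=d(p,x)^2$. Here it is used with $n=\ell$. Let $M,N$ be manifolds. An immersion $f:M\to N$ is with normal crossings at a point $y\in N$ if $f^{-1}(y)$ is a finite set $\{x_1,\ldots,x_k\}$ (distinct points) and for any subset $\{\lambda_1,\ldots,\lambda_s\}\subset\{1,\ldots,k\}$ ($s\le k$, the $\lambda_j$ distinct), $$\mathrm{codim}\Bigl(\bigcap_{j=1}^s df_{x_{\lambda_j}}(T_{x_{\lambda_j}}M)\Bigr)=\sum_{j=1}^s\mathrm{codim}\bigl(df_{x_{\lambda_j}}(T_{x_{\lambda_j}}M)\bigr),$$ where $\mathrm{codim}\,H=\dim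 T_yN-\dim H$ for a linear subspace $H$ of $T_yN$. An immersion $f:M\to N$ is with normal crossings if it is with normal crossings at every point $y\in N$. *)

theory Defs
  imports "HOL-Analysis.Analysis"
begin

section \<open>Smooth maps between open subsets of normed spaces\<close>

text \<open>On an open subset of a finite-dimensional space, being \<open>C\<^sup>k\<close> amounts to having
  directional derivatives \<open>x \<mapsto> Df(x) v\<close> of class \<open>C\<^sup>k\<^sup>-\<^sup>1\<close> for every fixed vector \<open>v\<close>.\<close>

primrec Ck_on :: "nat \<Rightarrow> ('a::real_normed_vector \<Rightarrow> 'b::real_normed_vector) \<Rightarrow> 'a set \<Rightarrow> bool" where
  "Ck_on 0 f S \<longleftrightarrow> continuous_on S f"
| "Ck_on (Suc k) f S \<longleftrightarrow> (\<forall>x\<in>S. f differentiable (at x)) \<and>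
     (\<forall>v. Ck_on k (\<lambda>x. frechet_derivative f (at x) v) S)"

definition Cinf_on :: "('a::real_normed_vector \<Rightarrow> 'b::real_normed_vector) \<Rightarrow> 'a set \<Rightarrow> bool" where
  "Cinf_on f S \<longleftrightarrow> (\<forall>k. Ck_on k f S)"


section \<open>Smooth manifolds\<close>

text \<open>A chart \<open>(U, \<phi>)\<close> consists of its domain and a map that is meaningful only on that domain.\<close>

type_synonym ('a, 'm) chart = "'a set \<times> ('a \<Rightarrow> (real ^ 'm))"

abbreviation chart_dom :: "('a, 'm) chart \<Rightarrow> 'a set" where
  "chart_dom c \<equiv> fst c"

abbreviation chart_map :: "('a, 'm) chart \<Rightarrow> 'a \<Rightarrow> real ^ 'm" where
  "chart_map c \<equiv> snd c"

abbreviation chart_inv :: "('a, 'm) chart \<Rightarrow> real ^ 'm \<Rightarrow> 'a" where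
  "chart_inv c \<equiv> inv_into (chart_dom c) (chart_map c)"

definition is_chart :: "'a topology \<Rightarrow> ('a, 'm::finite) chart \<Rightarrow> bool" where
  "is_chart X c \<longleftrightarrow> openin X (chart_dom c) \<and> open (chart_map c ` chart_dom c) \<and>
     homeomorphic_map (subtopology X (chart_dom c)) (top_of_set (chart_map c ` chart_dom c))
       (chart_map c)"

definition smooth_manifold :: "'a topology \<Rightarrow> ('a, 'm::finite) chart set \<Rightarrow> bool" where
  "smooth_manifold X A \<longleftrightarrow>
     Hausdorff_space X \<and> second_countable X \<and>
     (\<forall>c\<in>A. is_chart X c) \<and> (\<Union>c\<in>A. chart_dom c) = topspace X \<and>
     (\<forall>c\<in>A. \<forall>d\<in>A. Cinf_on (chart_map d \<circ> chart_inv c)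
        (chart_map c ` (chart_dom c \<inter> chart_dom d)))"

text \<open>Charts take values in open subsets of \<open>real ^ 'm\<close>, so there is no boundary.\<close>

definition closed_manifold :: "'a topology \<Rightarrow> ('a, 'm::finite) chart set \<Rightarrow> bool" where
  "closed_manifold X A \<longleftrightarrow> smooth_manifold X A \<and> compact_space X"


section \<open>Tangent spaces and differentials of maps into a normed space\<close>

text \<open>A tangent vector at \<open>x\<close> is a class of pairs (chart around \<open>x\<close>, coordinate vector), where
  coordinate vectors are identified by the derivative of the transition map.\<close>

definition tangent_rel ::
    "('a, 'm::finite) chart set \<Rightarrow> 'a \<Rightarrow> ((('a, 'm) chart \<times> (real ^ 'm)) \<times> (('a, 'm) chart \<times> (real ^ 'm))) set"
  where
  "tangent_rel A x = {((c, v), (d, w)). c \<in> A \<and> d \<in> A \<and> x \<in> chart_dom c \<and> x \<in> chart_dom d \<and>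
     w = frechet_derivative (chart_map d \<circ> chart_inv c) (at (chart_map c x)) v}"

definition tangent_space ::
    "('a, 'm::finite) chart set \<Rightarrow> 'a \<Rightarrow> (('a, 'm) chart \<times> (real ^ 'm)) set set" where
  "tangent_space A x = {(c, v). c \<in> A \<and> x \<in> chart_dom c} // tangent_rel A x"

text \<open>Maps go into a vector space, which is identified with each of its tangent spaces.\<close>

definition smooth_map :: "('a, 'm::finite) chart set \<Rightarrow> ('a \<Rightarrow> 'b::real_normed_vector) \<Rightarrow> bool" where
  "smooth_map A f \<longleftrightarrow> (\<forall>c\<in>A. Cinf_on (f \<circ> chart_inv c) (chart_map c ` chart_dom c))"

definition differential ::
    "('a \<Rightarrow> 'b::real_normed_vector) \<Rightarrow> 'a \<Rightarrow> (('a, 'm::finite) chart \<times> (real ^ 'm)) set \<Rightarrow> 'b" where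
  "differential f x \<xi> =
     the_elem ((\<lambda>(c, v). frechet_derivative (f \<circ> chart_inv c) (at (chart_map c x)) v) ` \<xi>)"


section \<open>Immersions with normal crossings\<close>

definition immersion :: "'a topology \<Rightarrow> ('a, 'm::finite) chart set \<Rightarrow> ('a \<Rightarrow> 'b::real_normed_vector) \<Rightarrow> bool"
  where
  "immersion X A f \<longleftrightarrow> smooth_map A f \<and>
     (\<forall>x\<in>topspace X. inj_on (differential f x) (tangent_space A x))"

definition codim :: "'b::euclidean_space set \<Rightarrow> nat" where
  "codim H = DIM('b) - dim H"

text \<open>For \<open>S = {}\<close> the codimension condition reads \<open>0 = 0\<close>.\<close>

definition normal_crossings_at ::
    "'a topology \<Rightarrow> ('a, 'm::finite) chart set \<Rightarrow> ('a \<Rightarrow> 'b::euclidean_space) \<Rightarrow> 'b \<Rightarrow> bool" where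
  "normal_crossings_at X A f y \<longleftrightarrow>
     finite {x \<in> topspace X. f x = y} \<and>
     (\<forall>S \<subseteq> {x \<in> topspace X. f x = y}.
        codim (\<Inter>x\<in>S. differential f x ` tangent_space A x) =
        (\<Sum>x\<in>S. codim (differential f x ` tangent_space A x)))"

definition immersion_with_normal_crossings ::
    "'a topology \<Rightarrow> ('a, 'm::finite) chart set \<Rightarrow> ('a \<Rightarrow> 'b::euclidean_space) \<Rightarrow> bool" where
  "immersion_with_normal_crossings X A f \<longleftrightarrow>
     immersion X A f \<and> (\<forall>y. normal_crossings_at X A f y)"


section \<open>Distance-squared mappings\<close>

definition distance_squared_mapping ::
    "('l \<Rightarrow> real ^ 'n) \<Rightarrow> real ^ 'n \<Rightarrow> real ^ 'l::finite" where
  "distance_squared_mapping p x = (\<chi> j. (dist (p j) x)\<^sup>2)"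

end

theory Submission
  imports Defs
begin

text \<open>
  The idea is to cut a small cap off the manifold. If \<open>p\<^sub>1, \<dots>, p\<^sub>\<ell>\<close> affinely span a hyperplane \<open>H\<close>, the
  distance-squared mapping is a fold along \<open>H\<close>: it identifies exactly the points that are mirror
  images in \<open>H\<close>, its derivative is an isomorphism off \<open>H\<close>, and on \<open>H\<close> the kernel of its derivative
  is the normal line (\<open>distance_squared_mapping_fibre\<close>, \<open>distance_squared_mapping_derivative_kernel\<close>).
  The hyperplane \<open>H\<close> is chosen close to a strictly highest point of the manifold, so that the fold
  creates no crossings beyond those of \<open>i\<close>.

  Let \<open>i q0\<close> be a point of the image farthest from some centre, and let \<open>v\<close> point from the centre to
  it. The height \<open>v \<bullet> i q\<close> is maximal only at the point \<open>i q0\<close>, where the tangent space is orthogonal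
  to \<open>v\<close>. Two preimages of this point would have tangent spaces in one hyperplane, against normal
  crossings, so \<open>q0\<close> is the only point of maximal height (\<open>highest_point_preimage_unique\<close>). The
  projection along \<open>v\<close> composed with \<open>i\<close> is an injective immersion on a neighbourhood \<open>U\<close> of \<open>q0\<close>
  (\<open>locally_injective_projection\<close>), and by compactness the rest of the manifold stays below some
  smaller height.

  Now let \<open>H\<close> be orthogonal to \<open>v\<close> at a height slightly below the maximum. The cap above \<open>H\<close>, its
  mirror image and the part of the manifold which that image could meet all belong to heights
  attained only in \<open>U\<close>. Reflection in \<open>H\<close> does not change the projection along \<open>v\<close>, so the folded cap
  meets nothing new; and since tangent spaces over \<open>U\<close> do not contain \<open>v\<close>, the fold is
  injective on them. Hence the composition is an immersion with the same fibres as \<open>i\<close>. Normal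
  crossings survive because the fold is locally a diffeomorphism off \<open>H\<close> and the points on \<open>H\<close> are
  simple (\<open>folded_immersion_with_normal_crossings\<close>).

  It remains to find \<open>m + 1\<close> affinely independent points of the image on \<open>H\<close>. In a chart around \<open>q0\<close>,
  the rays in the directions of the vertices of a simplex around the origin all cross \<open>H\<close>, and the
  crossing points are affinely independent because, up to positive factors, they are small perturbations
  of such vertices (\<open>simplex_in_level_near_peak\<close>). An affine basis of \<open>H\<close> that extends them
  supplies the other points.
\<close>

section \<open>Calculus of smooth maps on open sets\<close>

lemma Ck_on_cong:
  assumes "open S" "Ck_on k f S" "\<And>x. x \<in> S \<Longrightarrow> f x = g x"
  shows "Ck_on k g S"
  using assms(2,3)
proof (induction k arbitrary: f g)
  case 0
  then show ?case using continuous_on_cong by force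
next
  case (Suc k)
  have diff: "f differentiable (at x)" if "x \<in> S" for x
    using Suc.prems that by simp
  have "g differentiable (at x)" if x: "x \<in> S" for x
  proof -
    obtain D where "(f has_derivative D) (at x)"
      using diff[OF x] unfolding differentiable_def by blast
    then have "(g has_derivative D) (at x)"
      using has_derivative_transform_within_open \<open>open S\<close> x Suc.prems(2) by blast
    then show ?thesis by (rule differentiableI)
  qed
  moreover have "Ck_on k (\<lambda>x. frechet_derivative g (at x) v) S" for v
  proof (rule Suc.IH)
    show "Ck_on k (\<lambda>x. frechet_derivative f (at x) v) S"
      using Suc.prems by simp
    show "frechet_derivative f (at x) v = frechet_derivative g (at x) v" if "x \<in> S" for x
      using frechet_derivative_transform_within_open[OF diff[OF that] \<open>open S\<close> that Suc.prems(2)]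
      by simp
  qed
  ultimately show ?case by simp
qed

lemma Ck_on_SucI:
  assumes "open S" and der: "\<And>x. x \<in> S \<Longrightarrow> (f has_derivative f' x) (at x)"
    and "\<And>v. Ck_on k (\<lambda>x. f' x v) S"
  shows "Ck_on (Suc k) f S"
proof -
  have "frechet_derivative f (at x) = f' x" if "x \<in> S" for x
    using frechet_derivative_at[OF der[OF that]] by simp
  then have "Ck_on k (\<lambda>x. frechet_derivative f (at x) v) S" for v
    by (intro Ck_on_cong[OF \<open>open S\<close> assms(3)[of v]]) simp
  with der show ?thesis by (auto simp: differentiable_def)
qed

lemma Ck_on_SucD:
  assumes "Ck_on (Suc k) f S"
  shows "x \<in> S \<Longrightarrow> (f has_derivative frechet_derivative f (at x)) (at x)"
    and "Ck_on k (\<lambda>x. frechet_derivative f (at x) v) S"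
proof -
  show "(f has_derivative frechet_derivative f (at x)) (at x)" if "x \<in> S"
  proof (rule frechet_derivative_works[THEN iffD1])
    show "f differentiable (at x)" using assms that by simp
  qed
  show "Ck_on k (\<lambda>x. frechet_derivative f (at x) v) S" using assms by simp
qed

lemma Ck_on_Suc_imp:
  assumes "Ck_on (Suc k) f S"
  shows "Ck_on k f S"
  using assms
proof (induction k arbitrary: f)
  case 0
  then show ?case
    by (auto intro!: continuous_at_imp_continuous_on differentiable_imp_continuous_within)
next
  case (Suc k)
  then show ?case by simp
qed

lemma Ck_on_const:
  assumes "open S"
  shows "Ck_on k (\<lambda>x. c) S"
proof (induction k arbitrary: c)
  case (Suc k)
  show ?case
    by (rule Ck_on_SucI[OF assms, where f' = "\<lambda>x v. 0"]) (auto intro: Suc)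
qed simp

lemma Ck_on_add:
  assumes "open S" "Ck_on k f S" "Ck_on k g S"
  shows "Ck_on k (\<lambda>x. f x + g x) S"
  using assms(2,3)
proof (induction k arbitrary: f g)
  case 0
  then show ?case by (simp add: continuous_on_add)
next
  case (Suc k)
  show ?case
  proof (rule Ck_on_SucI[OF assms(1)])
    show "((\<lambda>x. f x + g x) has_derivative
        (\<lambda>v. frechet_derivative f (at x) v + frechet_derivative g (at x) v)) (at x)"
      if "x \<in> S" for x
      using Ck_on_SucD(1)[OF Suc.prems(1) that] Ck_on_SucD(1)[OF Suc.prems(2) that]
      by (rule has_derivative_add)
    show "Ck_on k (\<lambda>x. frechet_derivative f (at x) v + frechet_derivative g (at x) v) S" for v
      using Suc.IH[OF Ck_on_SucD(2)[OF Suc.prems(1)] Ck_on_SucD(2)[OF Suc.prems(2)]] .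
  qed
qed

lemma Ck_on_linear:
  assumes "open S" "bounded_linear L" "Ck_on k f S"
  shows "Ck_on k (\<lambda>x. L (f x)) S"
  using assms(3)
proof (induction k arbitrary: f)
  case 0
  then show ?case using bounded_linear.continuous_on[OF assms(2)] by simp
next
  case (Suc k)
  show ?case
  proof (rule Ck_on_SucI[OF assms(1)])
    show "((\<lambda>x. L (f x)) has_derivative (\<lambda>v. L (frechet_derivative f (at x) v))) (at x)"
      if "x \<in> S" for x
      using bounded_linear.has_derivative[OF assms(2) Ck_on_SucD(1)[OF Suc.prems that]] .
    show "Ck_on k (\<lambda>x. L (frechet_derivative f (at x) v)) S" for v
      using Suc.IH[OF Ck_on_SucD(2)[OF Suc.prems]] .
  qed
qed

text \<open>The product rule brings the factors themselves back into the directional derivative, which is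
  why the induction also needs that \<open>C\<^sup>k\<^sup>+\<^sup>1\<close> maps are \<open>C\<^sup>k\<close>.\<close>

lemma Ck_on_inner:
  fixes f g :: "_ \<Rightarrow> 'b::real_inner"
  assumes "open S" "Ck_on k f S" "Ck_on k g S"
  shows "Ck_on k (\<lambda>x. f x \<bullet> g x) S"
  using assms(2,3)
proof (induction k arbitrary: f g)
  case 0
  then show ?case by (simp add: continuous_on_inner)
next
  case (Suc k)
  show ?case
  proof (rule Ck_on_SucI[OF assms(1)])
    show "((\<lambda>x. f x \<bullet> g x) has_derivative
        (\<lambda>v. f x \<bullet> frechet_derivative g (at x) v + frechet_derivative f (at x) v \<bullet> g x)) (at x)"
      if "x \<in> S" for x
      using Ck_on_SucD(1)[OF Suc.prems(1) that] Ck_on_SucD(1)[OF Suc.prems(2) that]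
      by (rule has_derivative_inner)
    show "Ck_on k (\<lambda>x. f x \<bullet> frechet_derivative g (at x) v
        + frechet_derivative f (at x) v \<bullet> g x) S" for v
      using Ck_on_add[OF assms(1) Suc.IH Suc.IH]
        Ck_on_Suc_imp[OF Suc.prems(1)] Ck_on_Suc_imp[OF Suc.prems(2)]
        Ck_on_SucD(2)[OF Suc.prems(1)] Ck_on_SucD(2)[OF Suc.prems(2)] by blast
  qed
qed

lemma Cinf_onD:
  assumes "Cinf_on f S"
  shows "x \<in> S \<Longrightarrow> (f has_derivative frechet_derivative f (at x)) (at x)"
    and "continuous_on S (\<lambda>x. frechet_derivative f (at x) v)"
    and "continuous_on S f"
proof -
  have 1: "Ck_on (Suc 0) f S" and 0: "Ck_on 0 f S"
    using assms unfolding Cinf_on_def by blast+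
  show "(f has_derivative frechet_derivative f (at x)) (at x)" if "x \<in> S"
    by (rule Ck_on_SucD(1)[OF 1 that])
  show "continuous_on S (\<lambda>x. frechet_derivative f (at x) v)" using Ck_on_SucD(2)[OF 1] by simp
  show "continuous_on S f" using 0 by simp
qed

section \<open>Injectivity near a point\<close>

text \<open>On a finite-dimensional space the operator norm is bounded by the sum of the norms of the
  values on a basis, so continuity of all directional derivatives is continuity of the derivative.\<close>

lemma derivative_onorm_continuous:
  fixes g :: "'n::euclidean_space \<Rightarrow> 'b::euclidean_space"
  assumes "open W" "a \<in> W"
    and der: "\<And>z. z \<in> W \<Longrightarrow> (g has_derivative g' z) (at z)"
    and cont: "\<And>u. continuous_on W (\<lambda>z. g' z u)"
    and "e > 0"
  shows "\<exists>d>0. \<forall>z. dist a z < d \<longrightarrow> onorm (\<lambda>u. g' z u - g' a u) < e"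
proof -
  define F where "F z = (\<Sum>b\<in>Basis. norm (g' z b - g' a b))" for z
  have "continuous_on W F" unfolding F_def by (intro continuous_intros cont)
  then have "isCont F a" using assms(1,2) continuous_on_eq_continuous_at by blast
  moreover have "F a = 0" by (simp add: F_def)
  ultimately obtain d1 where d1: "d1 > 0" "\<And>z. dist z a < d1 \<Longrightarrow> dist (F z) 0 < e"
    using \<open>e > 0\<close> unfolding continuous_at_eps_delta by metis
  obtain d2 where d2: "d2 > 0" "ball a d2 \<subseteq> W"
    using assms(1,2) openE by blast
  have "onorm (\<lambda>u. g' z u - g' a u) < e" if "dist a z < min d1 d2" for z
  proof -
    have "z \<in> W" using that d2 by auto
    then have "bounded_linear (\<lambda>u. g' z u - g' a u)"
      using der \<open>a \<in> W\<close> by (intro bounded_linear_sub) (auto dest: has_derivative_bounded_linear)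
    then have "onorm (\<lambda>u. g' z u - g' a u) \<le> F z"
      unfolding F_def by (rule onorm_componentwise)
    also have "F z < e" using d1(2)[of z] that by (simp add: dist_commute)
    finally show ?thesis .
  qed
  then show ?thesis using d1(1) d2(1) by (intro exI[of _ "min d1 d2"]) auto
qed

text \<open>Local injectivity is the quantitative inverse function theorem. Injectivity of the
  derivative persists because an injective linear map satisfies \<open>B * norm u \<le> norm (g' a u)\<close> for some
  \<open>B > 0\<close>, which a perturbation of operator norm less than \<open>B\<close> cannot destroy.\<close>

lemma locally_injective_immersion:
  fixes g :: "'n::euclidean_space \<Rightarrow> 'b::euclidean_space"
  assumes "open W" "a \<in> W"
    and der: "\<And>z. z \<in> W \<Longrightarrow> (g has_derivative g' z) (at z)"
    and cont: "\<And>u. continuous_on W (\<lambda>z. g' z u)"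
    and inj: "inj (g' a)"
  obtains r where "r > 0" "ball a r \<subseteq> W" "inj_on g (ball a r)"
    "\<And>z u. z \<in> ball a r \<Longrightarrow> g' z u = 0 \<Longrightarrow> u = 0"
proof -
  have lin: "linear (g' a)" using der[OF \<open>a \<in> W\<close>] has_derivative_linear by blast
  have oc: "\<exists>d>0. \<forall>z. dist a z < d \<longrightarrow> onorm (\<lambda>u. g' z u - g' a u) < e" if "e > 0" for e
    using assms(1,2) der cont that by (rule derivative_onorm_continuous)
  obtain h where h: "linear h" "h \<circ> g' a = id"
    using linear_injective_left_inverse[OF lin inj] by blast
  have "bounded_linear h" using h(1) by (simp add: linear_conv_bounded_linear)
  then obtain r1 where r1: "r1 > 0" "ball a r1 \<subseteq> W" "inj_on g (ball a r1)"
    using has_derivative_locally_injective[OF assms(2,1) _ h(2) der oc] by blast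
  obtain B where B: "B > 0" "\<And>u. B * norm u \<le> norm (g' a u)"
    using linear_inj_bounded_below_pos[OF lin inj] by blast
  obtain d where d: "d > 0" "\<And>z. dist a z < d \<Longrightarrow> onorm (\<lambda>u. g' z u - g' a u) < B"
    using oc[OF B(1)] by blast
  have "u = 0" if z: "z \<in> ball a (min r1 d)" and 0: "g' z u = 0" for z u
  proof (rule ccontr)
    assume "u \<noteq> 0"
    have "z \<in> W" using z r1 by auto
    then have bl: "bounded_linear (\<lambda>u. g' z u - g' a u)"
      using der \<open>a \<in> W\<close> by (intro bounded_linear_sub) (auto dest: has_derivative_bounded_linear)
    have "B * norm u \<le> norm (g' z u - g' a u)" using B(2)[of u] 0 by simp
    also have "\<dots> \<le> onorm (\<lambda>u. g' z u - g' a u) * norm u" by (rule onorm[OF bl])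
    also have "\<dots> < B * norm u" using d(2)[of z] z \<open>u \<noteq> 0\<close> by simp
    finally show False by simp
  qed
  moreover have "inj_on g (ball a (min r1 d))" using r1(3) by (rule inj_on_subset) auto
  moreover have "ball a (min r1 d) \<subseteq> W" using r1(2) by auto
  ultimately show ?thesis using that[of "min r1 d"] r1(1) d(1) by auto
qed


section \<open>Charts\<close>

lemma smooth_manifold_chart:
  fixes A :: "('a, 'm::finite) chart set"
  assumes "smooth_manifold X A" "c \<in> A"
  shows "chart_dom c \<subseteq> topspace X" "inj_on (chart_map c) (chart_dom c)"
    "open (chart_map c ` chart_dom c)" "openin X (chart_dom c)"
    "homeomorphic_map (subtopology X (chart_dom c)) (top_of_set (chart_map c ` chart_dom c)) (chart_map c)"
proof -
  have c: "is_chart X c" using assms by (auto simp: smooth_manifold_def)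
  then show "open (chart_map c ` chart_dom c)" "openin X (chart_dom c)"
    and h: "homeomorphic_map (subtopology X (chart_dom c)) (top_of_set (chart_map c ` chart_dom c)) (chart_map c)"
    by (auto simp: is_chart_def)
  then show d: "chart_dom c \<subseteq> topspace X" using openin_subset by blast
  then show "inj_on (chart_map c) (chart_dom c)"
    using homeomorphic_imp_injective_map[OF h] by (simp add: Int_absorb1)
qed

lemma chart_inv_chart_map:
  fixes A :: "('a, 'm::finite) chart set"
  assumes "smooth_manifold X A" "c \<in> A" "x \<in> chart_dom c"
  shows "chart_inv c (chart_map c x) = x"
  using smooth_manifold_chart(2)[OF assms(1,2)] assms(3) by simp

lemma openin_chart_preimage:
  fixes A :: "('a, 'm::finite) chart set"
  assumes X: "smooth_manifold X A" "c \<in> A" and "open V"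
  shows "openin X {x \<in> chart_dom c. chart_map c x \<in> V}"
proof -
  note c = smooth_manifold_chart[OF X]
  have "continuous_map (subtopology X (chart_dom c)) euclidean (chart_map c)"
    using homeomorphic_imp_continuous_map[OF c(5)] continuous_map_in_subtopology by blast
  then have "openin (subtopology X (chart_dom c))
      {x \<in> topspace (subtopology X (chart_dom c)). chart_map c x \<in> V}"
    using open_openin[THEN iffD1, OF \<open>open V\<close>] by (rule openin_continuous_map_preimage)
  moreover have "topspace (subtopology X (chart_dom c)) = chart_dom c"
    using c(1) by auto
  ultimately have "openin (subtopology X (chart_dom c)) {x \<in> chart_dom c. chart_map c x \<in> V}"
    by (simp only:)
  then show ?thesis using c(4) by (rule openin_trans_full)
qed

lemma open_chart_image:
  fixes A :: "('a, 'm::finite) chart set"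
  assumes X: "smooth_manifold X A" "c \<in> A" and "openin X V"
  shows "open (chart_map c ` (chart_dom c \<inter> V))"
proof -
  note c = smooth_manifold_chart[OF X]
  have "open_map (subtopology X (chart_dom c)) (top_of_set (chart_map c ` chart_dom c)) (chart_map c)"
    using homeomorphic_imp_open_map[OF c(5)] .
  moreover have "openin (subtopology X (chart_dom c)) (chart_dom c \<inter> V)"
    using \<open>openin X V\<close> by (metis openin_subtopology_Int2)
  ultimately have "openin (top_of_set (chart_map c ` chart_dom c)) (chart_map c ` (chart_dom c \<inter> V))"
    unfolding open_map_def by blast
  then show ?thesis using c(3) openin_open_trans by blast
qed

lemma smooth_map_chart:
  assumes "smooth_map A f" "c \<in> A" "x \<in> chart_dom c"
  shows "((f \<circ> chart_inv c) has_derivative frechet_derivative (f \<circ> chart_inv c) (at (chart_map c x)))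
    (at (chart_map c x))"
  using assms Cinf_onD(1) unfolding smooth_map_def by blast

lemma smooth_map_continuous:
  fixes A :: "('a, 'm::finite) chart set"
  assumes X: "smooth_manifold X A" and "smooth_map A f"
  shows "continuous_map X euclidean f"
  unfolding continuous_map_def
proof (intro conjI allI impI)
  fix V :: "'b set" assume "openin euclidean V"
  then have V: "open V" by simp
  have "\<exists>T. openin X T \<and> x \<in> T \<and> T \<subseteq> {x \<in> topspace X. f x \<in> V}"
    if x: "x \<in> topspace X" "f x \<in> V" for x
  proof -
    obtain c where c: "c \<in> A" "x \<in> chart_dom c"
      using X x(1) unfolding smooth_manifold_def by blast
    let ?W = "chart_map c ` chart_dom c"
    have "continuous_on ?W (f \<circ> chart_inv c)"
      using assms(2) c(1) Cinf_onD(3) unfolding smooth_map_def by blast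
    then have "open (?W \<inter> (f \<circ> chart_inv c) -` V)"
      using smooth_manifold_chart(3)[OF X c(1)] V by (rule continuous_open_preimage)
    then have "openin X {x \<in> chart_dom c. chart_map c x \<in> ?W \<inter> (f \<circ> chart_inv c) -` V}"
      by (rule openin_chart_preimage[OF X c(1)])
    moreover have "{x \<in> chart_dom c. chart_map c x \<in> ?W \<inter> (f \<circ> chart_inv c) -` V}
        \<subseteq> {x \<in> topspace X. f x \<in> V}"
    proof
      fix z assume "z \<in> {x \<in> chart_dom c. chart_map c x \<in> ?W \<inter> (f \<circ> chart_inv c) -` V}"
      then have z: "z \<in> chart_dom c" and "f (chart_inv c (chart_map c z)) \<in> V" by simp_all
      then show "z \<in> {x \<in> topspace X. f x \<in> V}"
        using chart_inv_chart_map[OF X c(1) z] smooth_manifold_chart(1)[OF X c(1)] by auto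
    qed
    moreover have "x \<in> {x \<in> chart_dom c. chart_map c x \<in> ?W \<inter> (f \<circ> chart_inv c) -` V}"
      using x c chart_inv_chart_map[OF X c] by simp
    ultimately show ?thesis by blast
  qed
  then show "openin X {x \<in> topspace X. f x \<in> V}"
    by (subst openin_subopen) blast
qed auto

section \<open>The differential in a chart\<close>

text \<open>The chain rule for a change of chart. With a chart in place of \<open>f\<close> it is the cocycle
  condition behind the transitivity of \<open>tangent_rel\<close>; for general \<open>f\<close> it shows that the differential
  does not depend on the representative of a tangent vector.\<close>

lemma chart_change_derivative:
  fixes A :: "('a, 'm::finite) chart set"
  assumes X: "smooth_manifold X A"
    and c: "c \<in> A" "x \<in> chart_dom c" and d: "d \<in> A" "x \<in> chart_dom d"
    and f: "(f \<circ> chart_inv d) differentiable (at (chart_map d x))"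
  shows "frechet_derivative (f \<circ> chart_inv c) (at (chart_map c x)) v =
    frechet_derivative (f \<circ> chart_inv d) (at (chart_map d x))
      (frechet_derivative (chart_map d \<circ> chart_inv c) (at (chart_map c x)) v)"
proof -
  let ?\<tau> = "chart_map d \<circ> chart_inv c"
  let ?W = "chart_map c ` (chart_dom c \<inter> chart_dom d)"
  have W: "open ?W" using open_chart_image[OF X c(1)] smooth_manifold_chart(4)[OF X d(1)] .
  have xW: "chart_map c x \<in> ?W" using c d by blast
  have \<tau>x: "?\<tau> (chart_map c x) = chart_map d x" using chart_inv_chart_map[OF X c] by simp
  have "Cinf_on ?\<tau> ?W" using X c(1) d(1) unfolding smooth_manifold_def by blast
  then have D\<tau>: "(?\<tau> has_derivative frechet_derivative ?\<tau> (at (chart_map c x))) (at (chart_map c x))"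
    using Cinf_onD(1) xW by blast
  have "((f \<circ> chart_inv d) has_derivative frechet_derivative (f \<circ> chart_inv d) (at (chart_map d x)))
      (at (?\<tau> (chart_map c x)))"
    using f unfolding \<tau>x by (rule frechet_derivative_works[THEN iffD1])
  from diff_chain_at[OF D\<tau> this]
  have "((f \<circ> chart_inv d) \<circ> ?\<tau> has_derivative
      frechet_derivative (f \<circ> chart_inv d) (at (chart_map d x)) \<circ>
      frechet_derivative ?\<tau> (at (chart_map c x))) (at (chart_map c x))" .
  then have "(f \<circ> chart_inv c has_derivative
      frechet_derivative (f \<circ> chart_inv d) (at (chart_map d x)) \<circ>
      frechet_derivative ?\<tau> (at (chart_map c x))) (at (chart_map c x))"
  proof (rule has_derivative_transform_within_open[OF _ W xW])
    fix z assume "z \<in> ?W"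
    then show "((f \<circ> chart_inv d) \<circ> ?\<tau>) z = (f \<circ> chart_inv c) z"
      using chart_inv_chart_map[OF X c(1)] chart_inv_chart_map[OF X d(1)] by auto
  qed
  from frechet_derivative_at[OF this] show ?thesis by (metis comp_apply)
qed

lemma chart_transition_differentiable:
  fixes A :: "('a, 'm::finite) chart set"
  assumes X: "smooth_manifold X A"
    and c: "c \<in> A" "x \<in> chart_dom c" and d: "d \<in> A" "x \<in> chart_dom d"
  shows "(chart_map d \<circ> chart_inv c) differentiable (at (chart_map c x))"
proof -
  have "Cinf_on (chart_map d \<circ> chart_inv c) (chart_map c ` (chart_dom c \<inter> chart_dom d))"
    using X c(1) d(1) unfolding smooth_manifold_def by blast
  then show ?thesis using Cinf_onD(1) c d differentiableI by blast
qed

lemma chart_self_transition_derivative: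
  fixes A :: "('a, 'm::finite) chart set"
  assumes X: "smooth_manifold X A" and c: "c \<in> A" "x \<in> chart_dom c"
  shows "frechet_derivative (chart_map c \<circ> chart_inv c) (at (chart_map c x)) v = v"
proof -
  have "((\<lambda>z. z) has_derivative (\<lambda>v. v)) (at (chart_map c x))" by (rule has_derivative_ident)
  then have "((chart_map c \<circ> chart_inv c) has_derivative (\<lambda>v. v)) (at (chart_map c x))"
  proof (rule has_derivative_transform_within_open[OF _ smooth_manifold_chart(3)[OF X c(1)]])
    show "chart_map c x \<in> chart_map c ` chart_dom c" using c by blast
    show "z = (chart_map c \<circ> chart_inv c) z" if "z \<in> chart_map c ` chart_dom c" for z
      using that chart_inv_chart_map[OF X c(1)] by auto
  qed
  then show ?thesis using frechet_derivative_at by metis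
qed

text \<open>A fixed chart around \<open>x\<close> parametrises the whole tangent space, so that all later arguments
  can be carried out with the derivative of \<open>f \<circ> chart_inv c\<close> alone.\<close>

lemma tangent_space_chart:
  fixes A :: "('a, 'm::finite) chart set"
  assumes X: "smooth_manifold X A" and c: "c \<in> A" "x \<in> chart_dom c"
  shows "tangent_space A x = range (\<lambda>v. tangent_rel A x `` {(c, v)})"
proof
  show "range (\<lambda>v. tangent_rel A x `` {(c, v)}) \<subseteq> tangent_space A x"
  proof
    fix \<xi> assume "\<xi> \<in> range (\<lambda>v. tangent_rel A x `` {(c, v)})"
    then obtain v where "\<xi> = tangent_rel A x `` {(c, v)}" by blast
    moreover have "(c, v) \<in> {(c, v). c \<in> A \<and> x \<in> chart_dom c}" using c by simp
    ultimately show "\<xi> \<in> tangent_space A x"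
      unfolding tangent_space_def by (simp only: quotientI)
  qed
  show "tangent_space A x \<subseteq> range (\<lambda>v. tangent_rel A x `` {(c, v)})"
  proof
    fix \<xi> assume "\<xi> \<in> tangent_space A x"
    then obtain d w where d: "d \<in> A" "x \<in> chart_dom d" and \<xi>: "\<xi> = tangent_rel A x `` {(d, w)}"
      unfolding tangent_space_def quotient_def by auto
    let ?v = "frechet_derivative (chart_map c \<circ> chart_inv d) (at (chart_map d x)) w"
    have "frechet_derivative (chart_map k \<circ> chart_inv d) (at (chart_map d x)) w =
        frechet_derivative (chart_map k \<circ> chart_inv c) (at (chart_map c x)) ?v"
      if "k \<in> A" "x \<in> chart_dom k" for k
      using chart_change_derivative[OF X d c chart_transition_differentiable[OF X c that]] .
    then have "(((d, w), (k, u)) \<in> tangent_rel A x) = (((c, ?v), (k, u)) \<in> tangent_rel A x)"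
      for k u
      unfolding tangent_rel_def mem_Collect_eq prod.case using c d by metis
    then have "tangent_rel A x `` {(d, w)} = tangent_rel A x `` {(c, ?v)}"
      by (intro set_eqI) (simp add: Image_singleton split_paired_all)
    then show "\<xi> \<in> range (\<lambda>v. tangent_rel A x `` {(c, v)})" using \<xi> by blast
  qed
qed

lemma differential_chart:
  fixes A :: "('a, 'm::finite) chart set" and f :: "'a \<Rightarrow> 'b::real_normed_vector"
  assumes X: "smooth_manifold X A" and f: "smooth_map A f" and c: "c \<in> A" "x \<in> chart_dom c"
  shows "differential f x (tangent_rel A x `` {(c, v)}) =
    frechet_derivative (f \<circ> chart_inv c) (at (chart_map c x)) v" (is "_ = ?Dv")
proof -
  let ?\<delta> = "\<lambda>(d, w). frechet_derivative (f \<circ> chart_inv d) (at (chart_map d x)) w"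
  have \<delta>: "?\<delta> (d, w) = ?Dv" if "((c, v), (d, w)) \<in> tangent_rel A x" for d w
  proof -
    have d: "d \<in> A" "x \<in> chart_dom d"
      and w: "w = frechet_derivative (chart_map d \<circ> chart_inv c) (at (chart_map c x)) v"
      using that unfolding tangent_rel_def by auto
    have "(f \<circ> chart_inv d) differentiable (at (chart_map d x))"
      using smooth_map_chart[OF f d] differentiableI by blast
    from chart_change_derivative[OF X c d this] show ?thesis by (simp add: w)
  qed
  have "((c, v), (c, v)) \<in> tangent_rel A x"
    using c chart_self_transition_derivative[OF X c] unfolding tangent_rel_def by auto
  then have "tangent_rel A x `` {(c, v)} \<noteq> {}" by blast
  moreover have "?\<delta> \<eta> = ?\<delta> (c, v)" if "\<eta> \<in> tangent_rel A x `` {(c, v)}" for \<eta>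
    using that \<delta>[of "fst \<eta>" "snd \<eta>"] by (simp add: Image_singleton)
  ultimately have "the_elem (?\<delta> ` (tangent_rel A x `` {(c, v)})) = ?\<delta> (c, v)"
    by (rule the_elem_image_unique)
  then show ?thesis unfolding differential_def by simp
qed

lemma differential_image_chart:
  fixes A :: "('a, 'm::finite) chart set" and f :: "'a \<Rightarrow> 'b::real_normed_vector"
  assumes "smooth_manifold X A" "smooth_map A f" "c \<in> A" "x \<in> chart_dom c"
  shows "differential f x ` tangent_space A x =
    range (frechet_derivative (f \<circ> chart_inv c) (at (chart_map c x)))"
  unfolding tangent_space_chart[OF assms(1,3,4)] image_image differential_chart[OF assms] ..

lemma differential_inj_chart:
  fixes A :: "('a, 'm::finite) chart set" and f :: "'a \<Rightarrow> 'b::real_normed_vector"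
  assumes X: "smooth_manifold X A" and f: "smooth_map A f" and c: "c \<in> A" "x \<in> chart_dom c"
  shows "inj_on (differential f x) (tangent_space A x) \<longleftrightarrow>
    inj (frechet_derivative (f \<circ> chart_inv c) (at (chart_map c x)))"
proof -
  let ?cls = "\<lambda>v. tangent_rel A x `` {(c, v)}"
  have "v = w" if "?cls v = ?cls w" for v w
  proof -
    have "(c, v) \<in> ?cls v"
      using c chart_self_transition_derivative[OF X c] unfolding tangent_rel_def by auto
    then have "(c, v) \<in> ?cls w" using that by simp
    then show "v = w"
      using chart_self_transition_derivative[OF X c] unfolding tangent_rel_def by auto
  qed
  then have "inj ?cls" by (auto intro: injI)
  have "inj_on (differential f x) (tangent_space A x) \<longleftrightarrow> inj (differential f x \<circ> ?cls)"
    unfolding tangent_space_chart[OF X c] using \<open>inj ?cls\<close> comp_inj_on_iff by blast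
  also have "differential f x \<circ> ?cls = frechet_derivative (f \<circ> chart_inv c) (at (chart_map c x))"
    using differential_chart[OF assms] by (auto simp: o_def)
  finally show ?thesis .
qed


section \<open>Distance-squared mappings with foci spanning a hyperplane\<close>

text \<open>The points \<open>p j\<close> lie in the hyperplane \<open>v \<bullet> x = t\<close>, and affinely span it: a linear
  functional that is constant on them is constant on the hyperplane. The spanning condition is dual
  because equal distances to all \<open>p j\<close> say exactly that a functional is constant on them.\<close>

definition spans_hyperplane :: "('i \<Rightarrow> 'v::real_inner) \<Rightarrow> 'v \<Rightarrow> real \<Rightarrow> bool" where
  "spans_hyperplane p v t \<longleftrightarrow> (\<forall>j. v \<bullet> p j = t) \<and>
     (\<forall>w s. (\<forall>j. w \<bullet> p j = s) \<longrightarrow> (\<exists>r. w = r *\<^sub>R v))"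

text \<open>The only nonlinear term, \<open>x \<bullet> x\<close>, is common to all components.\<close>

lemma distance_squared_mapping_eq:
  "distance_squared_mapping p x =
     (\<chi> j. p j \<bullet> p j) + ((\<chi> j. - 2 * (p j \<bullet> x)) + (x \<bullet> x) *\<^sub>R 1)"
  by (simp add: distance_squared_mapping_def vec_eq_iff dist_norm power2_norm_eq_inner
      inner_diff_left inner_diff_right inner_commute)

lemma bounded_linear_inner_vector:
  fixes p :: "'l::finite \<Rightarrow> 'v::euclidean_space"
  shows "bounded_linear (\<lambda>x. (\<chi> j. - 2 * (p j \<bullet> x)) :: real ^ 'l)"
  unfolding linear_conv_bounded_linear[symmetric]
  by (rule linearI) (simp_all add: vec_eq_iff inner_add_right algebra_simps)

lemma has_derivative_distance_squared_mapping:
  "(distance_squared_mapping p has_derivative (\<lambda>w. \<chi> j. 2 * ((x - p j) \<bullet> w))) (at x)"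
proof -
  have "((\<lambda>x. (\<chi> j. p j \<bullet> p j) + ((\<chi> j. - 2 * (p j \<bullet> x)) + (x \<bullet> x) *\<^sub>R 1)) has_derivative
     (\<lambda>w. 0 + ((\<chi> j. - 2 * (p j \<bullet> w)) + (x \<bullet> w + w \<bullet> x) *\<^sub>R 1))) (at x)"
    by (intro has_derivative_add has_derivative_const has_derivative_scaleR_left
        has_derivative_inner has_derivative_ident
        bounded_linear_imp_has_derivative bounded_linear_inner_vector)
  moreover have "(\<lambda>w. 0 + ((\<chi> j. - 2 * (p j \<bullet> w)) + (x \<bullet> w + w \<bullet> x) *\<^sub>R 1)) =
      (\<lambda>w. \<chi> j. 2 * ((x - p j) \<bullet> w))"
    by (auto simp: vec_eq_iff inner_diff_left inner_diff_right inner_commute)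
  ultimately show ?thesis
    unfolding distance_squared_mapping_eq[abs_def] by simp
qed

lemma Cinf_on_distance_squared_mapping:
  assumes "open S" "Cinf_on f S"
  shows "Cinf_on (distance_squared_mapping p \<circ> f) S"
  unfolding Cinf_on_def
proof
  fix k
  have f: "Ck_on k f S" using assms(2) unfolding Cinf_on_def ..
  have "Ck_on k (\<lambda>x. (\<chi> j. p j \<bullet> p j) + ((\<chi> j. - 2 * (p j \<bullet> f x)) + (f x \<bullet> f x) *\<^sub>R 1)) S"
    by (intro Ck_on_add Ck_on_const assms(1) Ck_on_linear[OF assms(1) bounded_linear_inner_vector]
        Ck_on_linear[OF assms(1) bounded_linear_scaleR_left] Ck_on_inner f)
  then show "Ck_on k (distance_squared_mapping p \<circ> f) S"
    unfolding comp_def distance_squared_mapping_eq .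
qed

text \<open>The mapping folds space along the hyperplane: two points with the same image agree or are
  exchanged by the reflection in it. Indeed equal distances make \<open>(x - y) \<bullet> p j\<close> independent of \<open>j\<close>,
  so \<open>x - y\<close> is normal to the hyperplane, and along a normal line only the distance to the
  hyperplane counts.\<close>

lemma distance_squared_mapping_fibre:
  assumes p: "spans_hyperplane p v t"
    and eq: "distance_squared_mapping p x = distance_squared_mapping p y"
  obtains r where "x - y = r *\<^sub>R v" "r = 0 \<or> v \<bullet> x + v \<bullet> y = 2 * t"
proof -
  have j: "x \<bullet> x - 2 * (p j \<bullet> x) = y \<bullet> y - 2 * (p j \<bullet> y)" for j
    using eq unfolding distance_squared_mapping_eq vec_eq_iff by (simp add: algebra_simps)
  have "(x - y) \<bullet> p j = (x \<bullet> x - y \<bullet> y) / 2" for j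
    using j[of j] by (simp add: inner_diff_left inner_diff_right inner_commute)
  then obtain r where r: "x - y = r *\<^sub>R v"
    using p unfolding spans_hyperplane_def by meson
  have "r * (v \<bullet> x + v \<bullet> y) = (x - y) \<bullet> (x + y)"
    by (simp add: r inner_add_right distrib_left)
  also have "\<dots> = x \<bullet> x - y \<bullet> y" by (simp add: inner_simps inner_commute)
  also have "\<dots> = 2 * ((x - y) \<bullet> p undefined)"
    using j[of undefined] by (simp add: inner_diff_left inner_diff_right inner_commute)
  also have "\<dots> = r * (2 * t)" using p by (simp add: r spans_hyperplane_def)
  finally show ?thesis using that r by (metis mult_cancel_left)
qed

text \<open>The infinitesimal form of the preceding fold: the derivative is injective off the
  hyperplane, and its kernel on the hyperplane is the normal line.\<close>

lemma distance_squared_mapping_derivative_kernel: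
  fixes w :: "real ^ 'n"
  assumes p: "spans_hyperplane p v t"
    and 0: "(\<chi> j. 2 * ((x - p j) \<bullet> w)) = (0 :: real ^ 'l::finite)"
  obtains r where "w = r *\<^sub>R v" "r = 0 \<or> v \<bullet> x = t"
proof -
  have j: "w \<bullet> p j = w \<bullet> x" for j
    using 0 by (simp add: vec_eq_iff inner_diff_left inner_diff_right inner_commute)
  then obtain r where r: "w = r *\<^sub>R v" using p unfolding spans_hyperplane_def by meson
  have "r * t = r * (v \<bullet> x)" using j[of undefined] p by (simp add: r spans_hyperplane_def)
  then show ?thesis using that r by (metis mult_cancel_left)
qed

section \<open>Affine independence\<close>

text \<open>Affine independence of a family rather than of a set, hence with injectivity: two equal
  members of the family satisfy a nontrivial affine relation.\<close>

lemma affine_independent_rangeI: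
  fixes a :: "'i::finite \<Rightarrow> 'v::real_vector"
  assumes "\<And>c. (\<Sum>j\<in>UNIV. c j) = 0 \<Longrightarrow> (\<Sum>j\<in>UNIV. c j *\<^sub>R a j) = 0 \<Longrightarrow> c = (\<lambda>_. 0)"
  shows "inj a" "\<not> affine_dependent (range a)"
proof -
  show "inj a"
  proof (rule injI, rule ccontr)
    fix j k assume eq: "a j = a k" and "j \<noteq> k"
    define c :: "'i \<Rightarrow> real" where "c = (\<lambda>l. (if l = j then 1 else 0) - (if l = k then 1 else 0))"
    have "(\<Sum>l\<in>UNIV. c l) = 0" by (simp add: c_def sum_subtractf)
    moreover have "(\<Sum>l\<in>UNIV. c l *\<^sub>R a l) = 0"
      using eq by (simp add: c_def sum_subtractf scaleR_left_diff_distrib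
          if_distrib[of "\<lambda>s. s *\<^sub>R _"] cong: if_cong)
    ultimately have "c = (\<lambda>_. 0)" by (rule assms)
    then have "c j = 0" by simp
    with \<open>j \<noteq> k\<close> show False by (simp add: c_def)
  qed
  show "\<not> affine_dependent (range a)"
  proof
    assume "affine_dependent (range a)"
    then obtain U where U: "sum U (range a) = 0" "\<exists>x\<in>range a. U x \<noteq> 0"
      "(\<Sum>x\<in>range a. U x *\<^sub>R x) = 0"
      using affine_dependent_explicit_finite[of "range a"] by auto
    have "(\<lambda>j. U (a j)) = (\<lambda>_. 0)"
      using U(1,3) by (intro assms) (simp_all add: sum.reindex[OF \<open>inj a\<close>])
    then have "U (a j) = 0" for j by (rule fun_cong)
    with U(2) show False by auto
  qed
qed

text \<open>Affinely independent points of the hyperplane extend to an affine basis of it, and such a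
  basis has as many elements as the dimension of the space. The injection \<open>\<iota>\<close> prescribes which
  members of the final family are the given points.\<close>

lemma spans_hyperplane_extend:
  fixes a :: "'i::finite \<Rightarrow> 'v::euclidean_space" and \<iota> :: "'i \<Rightarrow> 'l::finite"
  assumes "v \<noteq> 0" and at: "\<And>j. v \<bullet> a j = t"
    and a: "inj a" "\<not> affine_dependent (range a)"
    and \<iota>: "inj \<iota>" and card: "CARD('l) = DIM('v)"
  obtains p :: "'l \<Rightarrow> 'v" where "spans_hyperplane p v t" "\<And>j. p (\<iota> j) = a j"
proof -
  let ?H = "{x. v \<bullet> x = t}"
  obtain T where T: "\<not> affine_dependent T" "range a \<subseteq> T" "T \<subseteq> ?H" "affine hull T = affine hull ?H"
    using extend_to_affine_basis[OF a(2), of ?H] at by blast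
  have hullT: "affine hull T = ?H" using T(4) affine_hyperplane[of v t] by (simp add: hull_same)
  have fT: "finite T" using T(1) affine_independent_iff_card by blast
  have "aff_dim T = DIM('v) - 1"
    using hullT aff_dim_hyperplane[OF \<open>v \<noteq> 0\<close>, of t] aff_dim_affine_hull by metis
  then have cT: "card T = CARD('l)"
    using aff_dim_affine_independent[OF T(1)] card by simp
  have "card (T - range a) = card (UNIV - range \<iota>)"
    using cT T(2) fT a(1) \<iota> by (simp add: card_Diff_subset card_image)
  then obtain g where g: "bij_betw g (UNIV - range \<iota>) (T - range a)"
    using finite_same_card_bij[of "UNIV - range \<iota>" "T - range a"] fT by auto
  define p where "p l = (if l \<in> range \<iota> then a (inv \<iota> l) else g l)" for l
  have p\<iota>: "p (\<iota> j) = a j" for j using \<iota> by (simp add: p_def)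
  have "range p = T"
  proof
    show "range p \<subseteq> T" using g T(2) by (auto simp: p_def bij_betw_def)
    show "T \<subseteq> range p"
    proof
      fix x assume "x \<in> T"
      show "x \<in> range p"
      proof (cases "x \<in> range a")
        case True
        then show ?thesis using p\<iota> by (metis imageE rangeI)
      next
        case False
        then obtain l where "l \<notin> range \<iota>" "x = g l"
          using g \<open>x \<in> T\<close> unfolding bij_betw_def by blast
        then show ?thesis by (auto simp: p_def)
      qed
    qed
  qed
  have "\<exists>r. w = r *\<^sub>R v" if w: "\<forall>l. w \<bullet> p l = s" for w s
  proof -
    have "T \<subseteq> {x. w \<bullet> x = s}" using w \<open>range p = T\<close> by auto
    then have H: "?H \<subseteq> {x. w \<bullet> x = s}"
      using hull_minimal[of T "{x. w \<bullet> x = s}" affine] affine_hyperplane[of w s] hullT by simp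
    \<comment> \<open>The foot \<open>x0\<close> of the perpendicular from the origin and its translate by the part \<open>u\<close> of \<open>w\<close>
      orthogonal to \<open>v\<close> lie in the hyperplane, so \<open>u\<close> is orthogonal to \<open>w\<close>, hence to itself.\<close>
    define r where "r = (w \<bullet> v) / (v \<bullet> v)"
    define u where "u = w - r *\<^sub>R v"
    define x0 where "x0 = (t / (v \<bullet> v)) *\<^sub>R v"
    have "v \<bullet> u = 0" using \<open>v \<noteq> 0\<close> by (simp add: u_def r_def inner_diff_right inner_commute)
    then have "w \<bullet> u = u \<bullet> u" by (simp add: u_def inner_diff_left)
    have "x0 \<in> ?H" using \<open>v \<noteq> 0\<close> by (simp add: x0_def)
    then have "x0 + u \<in> ?H" using \<open>v \<bullet> u = 0\<close> by (simp add: inner_add_right)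
    have "w \<bullet> x0 = s" "w \<bullet> (x0 + u) = s"
      using H \<open>x0 \<in> ?H\<close> \<open>x0 + u \<in> ?H\<close> by blast+
    then have "w \<bullet> u = 0" by (simp add: inner_add_right)
    then have "u = 0" using \<open>w \<bullet> u = u \<bullet> u\<close> by simp
    then show ?thesis unfolding u_def by auto
  qed
  moreover have "v \<bullet> p l = t" for l using T(3) \<open>range p = T\<close> by blast
  ultimately have "spans_hyperplane p v t" unfolding spans_hyperplane_def by blast
  then show ?thesis using that p\<iota> by blast
qed

text \<open>The vertices of a simplex with \<open>0\<close> in its interior: the unit vectors and minus their sum.\<close>

definition simplex_vertex :: "'m::finite option \<Rightarrow> real ^ 'm" where
  "simplex_vertex j = (case j of None \<Rightarrow> - 1 | Some i \<Rightarrow> axis i 1)"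

lemma sum_UNIV_option:
  fixes f :: "'m::finite option \<Rightarrow> 'b::comm_monoid_add"
  shows "(\<Sum>j\<in>UNIV. f j) = f None + (\<Sum>i\<in>UNIV. f (Some i))"
  by (simp add: UNIV_option_conv sum.reindex)

text \<open>The vertices add up to \<open>0\<close>, and every linear relation among them is a multiple of this one, with
  all coefficients equal. After a small perturbation the coefficients of a relation are therefore nearly
  equal, compared with the largest of them, and so cannot have both signs unless they all vanish.\<close>

lemma perturbed_simplex_no_signed_relation:
  fixes y :: "'m::finite option \<Rightarrow> real ^ 'm"
  assumes y: "\<And>j. norm (y j - simplex_vertex j) \<le> \<epsilon>"
    and \<epsilon>: "2 * \<epsilon> * real (CARD('m) + 1) < 1"
    and rel: "(\<Sum>j\<in>UNIV. d j *\<^sub>R y j) = 0"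
    and sign: "d j\<^sub>0 \<le> 0" "0 \<le> d j\<^sub>1"
    and max: "\<And>j. \<bar>d j\<bar> \<le> \<bar>d j\<^sub>2\<bar>"
  shows "d j = 0"
proof -
  define D where "D = \<bar>d j\<^sub>2\<bar>"
  have "\<epsilon> \<ge> 0" using y[of None] norm_ge_zero order_trans by blast
  have close: "\<bar>d (Some i) - d None\<bar> \<le> \<epsilon> * real (CARD('m) + 1) * D" for i
  proof -
    have "(\<Sum>j\<in>UNIV. d j *\<^sub>R simplex_vertex j) = (\<Sum>j\<in>UNIV. d j *\<^sub>R (simplex_vertex j - y j))"
      using rel by (simp add: algebra_simps sum_subtractf)
    moreover have "(\<Sum>j\<in>UNIV. d j *\<^sub>R simplex_vertex j) $ i = d (Some i) - d None"
      by (simp add: sum_UNIV_option simplex_vertex_def axis_def if_distrib[of "\<lambda>x. _ * x"] cong: if_cong)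
    ultimately have "\<bar>d (Some i) - d None\<bar> \<le> norm (\<Sum>j\<in>UNIV. d j *\<^sub>R (simplex_vertex j - y j))"
      using component_le_norm_cart by metis
    also have "\<dots> \<le> (\<Sum>j\<in>(UNIV::'m option set). D * \<epsilon>)"
    proof (rule sum_norm_le)
      show "norm (d j *\<^sub>R (simplex_vertex j - y j)) \<le> D * \<epsilon>" for j
        using max[of j] y[of j] \<open>\<epsilon> \<ge> 0\<close> by (auto simp: D_def norm_minus_commute intro!: mult_mono)
    qed
    also have "\<dots> = \<epsilon> * real (CARD('m) + 1) * D" by simp
    finally show ?thesis .
  qed
  have small: "2 * (\<epsilon> * real (CARD('m) + 1) * D) < D" if "D > 0"
    using mult_strict_right_mono[OF \<epsilon> that] by (simp add: mult_ac)
  have pair: "\<bar>d j - d k\<bar> \<le> 2 * (\<epsilon> * real (CARD('m) + 1) * D)" for j k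
  proof -
    have "0 \<le> \<epsilon> * real (CARD('m) + 1) * D" using \<open>\<epsilon> \<ge> 0\<close> by (simp add: D_def)
    moreover have "\<bar>d l - d None\<bar> \<le> \<epsilon> * real (CARD('m) + 1) * D" for l
      using close calculation by (cases l) auto
    from this[of j] this[of k] show ?thesis by linarith
  qed
  \<comment> \<open>One of \<open>d j\<^sub>0\<close> and \<open>d j\<^sub>1\<close> lies on the other side of \<open>0\<close> from the value of largest modulus, at a
    distance of at least \<open>D\<close> from it.\<close>
  have "D \<le> 2 * (\<epsilon> * real (CARD('m) + 1) * D)"
    using pair[of j\<^sub>2 j\<^sub>0] pair[of j\<^sub>2 j\<^sub>1] sign unfolding D_def by linarith
  with small have "D = 0" unfolding D_def by fastforce
  then show ?thesis using max[of j] by (simp add: D_def)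
qed

text \<open>Positive factors \<open>s j\<close> are harmless: the coefficients of an affine relation add up to \<open>0\<close>, so
  they have both signs or vanish, and then so do those of the resulting linear relation among the \<open>y j\<close>. Hence the
  factors may be of quite different sizes, which matters below, where they come from the
  intermediate value theorem.\<close>

lemma perturbed_simplex_affine_independent:
  fixes y :: "'m::finite option \<Rightarrow> real ^ 'm"
  assumes y: "\<And>j. norm (y j - simplex_vertex j) \<le> \<epsilon>"
    and \<epsilon>: "2 * \<epsilon> * real (CARD('m) + 1) < 1"
    and s: "\<And>j. s j > 0"
    and c: "(\<Sum>j\<in>UNIV. c j) = 0" and rel: "(\<Sum>j\<in>UNIV. c j *\<^sub>R s j *\<^sub>R y j) = 0"
  shows "c = (\<lambda>_. 0)"
proof -
  have neg: "\<exists>j. c j \<le> 0"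
  proof (rule ccontr)
    assume "\<nexists>j. c j \<le> 0"
    then have "(\<Sum>j\<in>UNIV. c j) > 0" by (intro sum_pos) (auto simp: not_le)
    with c show False by simp
  qed
  have pos: "\<exists>j. 0 \<le> c j"
  proof (rule ccontr)
    assume "\<nexists>j. 0 \<le> c j"
    then have "(\<Sum>j\<in>UNIV. - c j) > 0" by (intro sum_pos) (auto simp: not_le)
    with c show False by (simp add: sum_negf)
  qed
  from neg pos obtain j0 j1 where j: "c j0 \<le> 0" "0 \<le> c j1" by blast
  let ?d = "\<lambda>j. c j * s j"
  have "Max (range (\<lambda>j. \<bar>?d j\<bar>)) \<in> range (\<lambda>j. \<bar>?d j\<bar>)" by (rule Max_in) auto
  then obtain j2 where j2: "\<bar>?d j2\<bar> = Max (range (\<lambda>j. \<bar>?d j\<bar>))" by force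
  have "?d k = 0" for k
  proof (rule perturbed_simplex_no_signed_relation[OF y \<epsilon>])
    show "(\<Sum>j\<in>UNIV. ?d j *\<^sub>R y j) = 0" using rel by simp
    show "?d j0 \<le> 0" using j(1) s[of j0] by (simp add: mult_nonpos_nonneg)
    show "0 \<le> ?d j1" using j(2) s[of j1] by simp
    show "\<bar>?d j\<bar> \<le> \<bar>?d j2\<bar>" for j unfolding j2 by (rule Max_ge) auto
  qed
  then show ?thesis using s by (metis less_irrefl mult_eq_0_iff)
qed


section \<open>The highest point of a closed immersed manifold\<close>

lemma tangent_image_subspace:
  fixes A :: "('a, 'm::finite) chart set" and f :: "'a \<Rightarrow> 'b::euclidean_space"
  assumes X: "smooth_manifold X A" and f: "smooth_map A f" and x: "x \<in> topspace X"
  shows "subspace (differential f x ` tangent_space A x)"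
proof -
  obtain c where c: "c \<in> A" "x \<in> chart_dom c"
    using X x unfolding smooth_manifold_def by blast
  have "linear (frechet_derivative (f \<circ> chart_inv c) (at (chart_map c x)))"
    using smooth_map_chart[OF f c] by (rule has_derivative_linear)
  then show ?thesis
    unfolding differential_image_chart[OF X f c] by (rule linear_subspace_image) simp
qed

lemma tangent_image_at_highest_point:
  fixes A :: "('a, 'm::finite) chart set" and f :: "'a \<Rightarrow> 'b::euclidean_space"
  assumes X: "smooth_manifold X A" and f: "smooth_map A f" and x: "x \<in> topspace X"
    and top: "\<And>y. y \<in> topspace X \<Longrightarrow> v \<bullet> f y \<le> v \<bullet> f x"
  shows "differential f x ` tangent_space A x \<subseteq> {w. v \<bullet> w = 0}"
proof -
  obtain c where c: "c \<in> A" "x \<in> chart_dom c"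
    using X x unfolding smooth_manifold_def by blast
  let ?g = "\<lambda>z. v \<bullet> (f \<circ> chart_inv c) z"
  let ?D = "frechet_derivative (f \<circ> chart_inv c) (at (chart_map c x))"
  have "(\<lambda>w. v \<bullet> ?D w) = (\<lambda>w. 0)"
  proof (rule differential_zero_maxmin[where S = "chart_map c ` chart_dom c"])
    show "(?g has_derivative (\<lambda>w. v \<bullet> ?D w)) (at (chart_map c x))"
      using smooth_map_chart[OF f c] by (rule has_derivative_inner_right)
    have "?g z \<le> ?g (chart_map c x)" if z: "z \<in> chart_map c ` chart_dom c" for z
    proof -
      obtain y where y: "y \<in> chart_dom c" "z = chart_map c y" using z by blast
      then have "y \<in> topspace X" using smooth_manifold_chart(1)[OF X c(1)] by blast
      then show ?thesis
        using top chart_inv_chart_map[OF X c(1) y(1)] chart_inv_chart_map[OF X c] y(2) by simp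
    qed
    then show "(\<forall>z\<in>chart_map c ` chart_dom c. ?g z \<le> ?g (chart_map c x)) \<or>
      (\<forall>z\<in>chart_map c ` chart_dom c. ?g (chart_map c x) \<le> ?g z)" by blast
  qed (use c smooth_manifold_chart(3)[OF X c(1)] in auto)
  then have "v \<bullet> ?D w = 0" for w by (rule fun_cong)
  then show ?thesis unfolding differential_image_chart[OF X f c] by auto
qed

text \<open>Codimensions add only for subspaces that together span the space.\<close>

lemma codim_Int_of_subspaces_in_hyperplane:
  fixes S T :: "'b::euclidean_space set"
  assumes "subspace S" "subspace T" "v \<noteq> 0" "S \<subseteq> {w. v \<bullet> w = 0}" "T \<subseteq> {w. v \<bullet> w = 0}"
  shows "codim (S \<inter> T) < codim S + codim T"
proof -
  have "dim {x + y |x y. x \<in> S \<and> y \<in> T} \<le> dim {w. v \<bullet> w = 0}"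
    using assms(4,5) by (intro dim_subset) (fastforce simp: inner_add_right)
  also have "\<dots> < DIM('b)" using dim_hyperplane[OF \<open>v \<noteq> 0\<close>] by simp
  finally show ?thesis
    using dim_sums_Int[OF assms(1,2)] dim_subset_UNIV[of S] dim_subset_UNIV[of T]
      dim_subset_UNIV[of "S \<inter> T"]
    unfolding codim_def by linarith
qed

text \<open>At two preimages of a highest point both tangent spaces would lie in the same hyperplane,
  which normal crossings exclude.\<close>

lemma highest_point_preimage_unique:
  fixes A :: "('a, 'm::finite) chart set" and f :: "'a \<Rightarrow> 'b::euclidean_space"
  assumes X: "smooth_manifold X A" and f: "immersion_with_normal_crossings X A f"
    and x: "x \<in> topspace X" "v \<noteq> 0"
    and top: "\<And>y. y \<in> topspace X \<Longrightarrow> v \<bullet> f y \<le> v \<bullet> f x"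
    and y: "y \<in> topspace X" "f y = f x"
  shows "y = x"
proof (rule ccontr)
  assume "y \<noteq> x"
  have sm: "smooth_map A f"
    using f unfolding immersion_with_normal_crossings_def immersion_def by blast
  let ?T = "\<lambda>q. differential f q ` tangent_space A q"
  have "{x, y} \<subseteq> {q \<in> topspace X. f q = f x}" using x y by auto
  then have "codim (\<Inter>q\<in>{x, y}. ?T q) = (\<Sum>q\<in>{x, y}. codim (?T q))"
    using f unfolding immersion_with_normal_crossings_def normal_crossings_at_def by blast
  then have "codim (?T x \<inter> ?T y) = codim (?T x) + codim (?T y)" using \<open>y \<noteq> x\<close> by simp
  moreover have "codim (?T x \<inter> ?T y) < codim (?T x) + codim (?T y)"
    using x y top tangent_image_subspace[OF X sm] tangent_image_at_highest_point[OF X sm]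
    by (intro codim_Int_of_subspaces_in_hyperplane[of _ _ v]) simp_all
  ultimately show False by simp
qed

text \<open>Follow \<open>f\<close> along the rays from \<open>z\<^sub>0\<close> in the directions of the simplex vertices. On every ray the
  height falls from its maximum, so by the intermediate value theorem it takes each slightly
  smaller value \<open>t\<close> at some point. These points need not be equally far from \<open>z\<^sub>0\<close>, but a left inverse
  of \<open>L\<close> maps their displacements from \<open>f z\<^sub>0\<close> to positive multiples of slightly perturbed simplex vertices,
  so they are affinely independent.\<close>

lemma simplex_in_level_near_peak:
  fixes f :: "real ^ 'm::finite \<Rightarrow> 'b::euclidean_space"
  assumes W: "open W" "z\<^sub>0 \<in> W" and cont: "continuous_on W f"
    and der: "(f has_derivative L) (at z\<^sub>0)" and inj: "inj L"
    and peak: "\<And>z. z \<in> W \<Longrightarrow> z \<noteq> z\<^sub>0 \<Longrightarrow> v \<bullet> f z < v \<bullet> f z\<^sub>0"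
  obtains t\<^sub>1 where "t\<^sub>1 < v \<bullet> f z\<^sub>0"
    "\<And>t. t\<^sub>1 < t \<Longrightarrow> t < v \<bullet> f z\<^sub>0 \<Longrightarrow> \<exists>a :: 'm option \<Rightarrow> 'b.
       range a \<subseteq> f ` W \<and> (\<forall>j. v \<bullet> a j = t) \<and> inj a \<and> \<not> affine_dependent (range a)"
proof -
  let ?w = "simplex_vertex :: 'm option \<Rightarrow> real ^ 'm"
  have w0: "?w j \<noteq> 0" for j
    by (cases j) (simp_all add: simplex_vertex_def axis_eq_0_iff)
  \<comment> \<open>\<open>K\<close> bounds the directions, \<open>\<epsilon>\<close> is the perturbation that the simplex tolerates, and on the rays
    up to parameter \<open>\<sigma>\<close> the linearisation error stays below \<open>\<epsilon>\<close> times the parameter.\<close>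
  define K where "K = 1 + (\<Sum>j\<in>UNIV. norm (?w j))"
  have K: "norm (?w j) \<le> K" for j
    unfolding K_def using member_le_sum[of j UNIV "\<lambda>j. norm (?w j)"] by simp
  have "K > 0" unfolding K_def by (simp add: add_pos_nonneg sum_nonneg)
  define \<epsilon> where "\<epsilon> = 1 / (4 * real (CARD('m) + 1))"
  have "\<epsilon> > 0" and \<epsilon>: "2 * \<epsilon> * real (CARD('m) + 1) < 1" unfolding \<epsilon>_def by simp_all
  obtain h where h: "linear h" "h \<circ> L = id"
    using linear_injective_left_inverse[OF has_derivative_linear[OF der] inj] by blast
  have "bounded_linear h" using h(1) by (simp add: linear_conv_bounded_linear)
  from bounded_linear.has_derivative[OF this der]
  have "((\<lambda>z. h (f z)) has_derivative (\<lambda>u. h (L u))) (at z\<^sub>0)" .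
  moreover have "(\<lambda>u. h (L u)) = (\<lambda>u. u)" using h(2) by (simp add: fun_eq_iff)
  ultimately have "((\<lambda>z. h (f z)) has_derivative (\<lambda>u. u)) (at z\<^sub>0)" by simp
  moreover have "\<epsilon> / K > 0" using \<open>\<epsilon> > 0\<close> \<open>K > 0\<close> by simp
  ultimately obtain \<delta>1 where \<delta>1: "\<delta>1 > 0" "\<And>z. norm (z - z\<^sub>0) < \<delta>1 \<Longrightarrow>
      norm (h (f z) - h (f z\<^sub>0) - (z - z\<^sub>0)) \<le> \<epsilon> / K * norm (z - z\<^sub>0)"
    unfolding has_derivative_at_alt by blast
  obtain \<delta>2 where \<delta>2: "\<delta>2 > 0" "ball z\<^sub>0 \<delta>2 \<subseteq> W" using W openE by blast
  define \<sigma> where "\<sigma> = min \<delta>1 \<delta>2 / (2 * K)"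
  have "\<sigma> > 0" using \<delta>1(1) \<delta>2(1) \<open>K > 0\<close> by (simp add: \<sigma>_def)
  have short: "norm (s *\<^sub>R ?w j) < min \<delta>1 \<delta>2" if "0 \<le> s" "s \<le> \<sigma>" for s j
  proof -
    have "norm (s *\<^sub>R ?w j) \<le> \<sigma> * K" using that K[of j] by (auto intro!: mult_mono)
    also have "\<dots> = min \<delta>1 \<delta>2 / 2" using \<open>K > 0\<close> by (simp add: \<sigma>_def)
    also have "\<dots> < min \<delta>1 \<delta>2" using \<delta>1(1) \<delta>2(1) by linarith
    finally show ?thesis .
  qed
  have inW: "z\<^sub>0 + s *\<^sub>R ?w j \<in> W" if "0 \<le> s" "s \<le> \<sigma>" for s j
    using short[OF that, of j] \<delta>2(2) by (auto simp: dist_norm subset_iff)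
  define g where "g j s = v \<bullet> f (z\<^sub>0 + s *\<^sub>R ?w j)" for j s
  have gcont: "continuous_on {0..\<sigma>} (g j)" for j
    unfolding g_def
    by (intro continuous_intros continuous_on_compose2[OF cont]) (use inW in auto)
  define t\<^sub>1 where "t\<^sub>1 = Max (range (\<lambda>j. g j \<sigma>))"
  have t1: "g j \<sigma> \<le> t\<^sub>1" for j unfolding t\<^sub>1_def by (rule Max_ge) auto
  show ?thesis
  proof (rule that)
    have "g j \<sigma> < v \<bullet> f z\<^sub>0" for j
      unfolding g_def using \<open>\<sigma> > 0\<close> w0[of j] by (intro peak inW) auto
    then show "t\<^sub>1 < v \<bullet> f z\<^sub>0" unfolding t\<^sub>1_def by (subst Max_less_iff) auto
  next
    fix t assume t: "t\<^sub>1 < t" "t < v \<bullet> f z\<^sub>0"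
    have "\<exists>s. 0 < s \<and> s \<le> \<sigma> \<and> g j s = t" for j
    proof -
      have "\<exists>s. 0 \<le> s \<and> s \<le> \<sigma> \<and> g j s = t"
        using t t1[of j] \<open>\<sigma> > 0\<close> gcont[of j] by (intro IVT2') (auto simp: g_def)
      moreover have "g j 0 \<noteq> t" using t by (simp add: g_def)
      ultimately show ?thesis by (metis order_le_less)
    qed
    then obtain s where s: "\<And>j. 0 < s j" "\<And>j. s j \<le> \<sigma>" "\<And>j. g j (s j) = t" by metis
    define z where "z j = z\<^sub>0 + s j *\<^sub>R ?w j" for j
    define a where "a j = f (z j)" for j
    define y where "y j = (1 / s j) *\<^sub>R (h (a j) - h (f z\<^sub>0))" for j
    have y: "norm (y j - ?w j) \<le> \<epsilon>" for j
    proof -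
      have "norm (z j - z\<^sub>0) < \<delta>1" using short[of "s j" j] s[of j] by (simp add: z_def)
      then have "norm (h (a j) - h (f z\<^sub>0) - s j *\<^sub>R ?w j) \<le> \<epsilon> / K * norm (s j *\<^sub>R ?w j)"
        using \<delta>1(2)[of "z j"] by (simp add: z_def a_def)
      moreover have "h (a j) - h (f z\<^sub>0) - s j *\<^sub>R ?w j = s j *\<^sub>R (y j - ?w j)"
        using s(1)[of j] by (simp add: y_def scaleR_right_diff_distrib)
      ultimately have "s j * norm (y j - ?w j) \<le> s j * (\<epsilon> / K * norm (?w j))"
        using s(1)[of j] by (simp add: mult_ac)
      then have "norm (y j - ?w j) \<le> \<epsilon> / K * norm (?w j)"
        by (rule mult_left_le_imp_le) (rule s(1))
      also have "\<dots> \<le> \<epsilon> / K * K" using K[of j] \<open>\<epsilon> / K > 0\<close> by (intro mult_left_mono) simp_all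
      finally show ?thesis using \<open>K > 0\<close> by simp
    qed
    have indep: "c = (\<lambda>_. 0)"
      if c: "(\<Sum>j\<in>UNIV. c j) = 0" "(\<Sum>j\<in>UNIV. c j *\<^sub>R a j) = 0" for c
    proof (rule perturbed_simplex_affine_independent[OF y \<epsilon> s(1) c(1)])
      have "(\<Sum>j\<in>UNIV. c j *\<^sub>R s j *\<^sub>R y j) = (\<Sum>j\<in>UNIV. c j *\<^sub>R (h (a j) - h (f z\<^sub>0)))"
        using s(1) by (intro sum.cong) (simp_all add: y_def less_imp_neq[symmetric])
      also have "\<dots> = (\<Sum>j\<in>UNIV. c j *\<^sub>R h (a j)) - (\<Sum>j\<in>UNIV. c j) *\<^sub>R h (f z\<^sub>0)"
        by (simp add: scaleR_right_diff_distrib sum_subtractf scaleR_left.sum)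
      also have "(\<Sum>j\<in>UNIV. c j *\<^sub>R h (a j)) = h (\<Sum>j\<in>UNIV. c j *\<^sub>R a j)"
        using h(1) by (simp add: linear_sum linear_scale)
      finally show "(\<Sum>j\<in>UNIV. c j *\<^sub>R s j *\<^sub>R y j) = 0"
        using c h(1) by (simp add: linear_0)
    qed
    have "range a \<subseteq> f ` W"
      using inW s by (auto simp: a_def z_def less_imp_le)
    moreover have "v \<bullet> a j = t" for j using s(3)[of j] by (simp add: a_def z_def g_def)
    ultimately show "\<exists>a :: 'm option \<Rightarrow> 'b. range a \<subseteq> f ` W \<and> (\<forall>j. v \<bullet> a j = t) \<and> inj a
        \<and> \<not> affine_dependent (range a)"
      using affine_independent_rangeI[OF indep] by blast
  qed
qed

text \<open>The orthogonal projection along \<open>v\<close> fixes the range of the derivative at \<open>a\<close>. So its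
  composition with \<open>f\<close> is an immersion at \<open>a\<close>, and hence an injective immersion nearby.\<close>

lemma locally_injective_projection:
  fixes f :: "'n::euclidean_space \<Rightarrow> 'b::euclidean_space"
  assumes W: "open W" "a \<in> W" and f: "Cinf_on f W"
    and inj: "inj (frechet_derivative f (at a))"
    and v: "v \<noteq> 0" "range (frechet_derivative f (at a)) \<subseteq> {w. v \<bullet> w = 0}"
  obtains r where "r > 0" "ball a r \<subseteq> W"
    "\<And>z z' s. z \<in> ball a r \<Longrightarrow> z' \<in> ball a r \<Longrightarrow> f z - f z' = s *\<^sub>R v \<Longrightarrow> z = z'"
    "\<And>z u s. z \<in> ball a r \<Longrightarrow> frechet_derivative f (at z) u = s *\<^sub>R v \<Longrightarrow> u = 0"
proof -
  define \<pi> where "\<pi> w = w - ((v \<bullet> w) / (v \<bullet> v)) *\<^sub>R v" for w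
  have \<pi>v: "\<pi> (s *\<^sub>R v) = 0" for s using v(1) by (simp add: \<pi>_def)
  have lin: "linear \<pi>"
    by (rule linearI) (simp_all add: \<pi>_def inner_add_right algebra_simps add_divide_distrib)
  then have bl: "bounded_linear \<pi>" by (simp add: linear_conv_bounded_linear)
  let ?D = "\<lambda>z. frechet_derivative f (at z)"
  have "((\<lambda>z. \<pi> (f z)) has_derivative (\<lambda>u. \<pi> (?D z u))) (at z)" if "z \<in> W" for z
    using bounded_linear.has_derivative[OF bl Cinf_onD(1)[OF f that]] .
  moreover have "continuous_on W (\<lambda>z. \<pi> (?D z u))" for u
    using bounded_linear.continuous_on[OF bl Cinf_onD(2)[OF f]] .
  moreover have "inj (\<lambda>u. \<pi> (?D a u))"
  proof -
    have "\<pi> (?D a u) = ?D a u" for u using v(2) by (auto simp: \<pi>_def)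
    with inj show ?thesis by simp
  qed
  ultimately obtain r where r: "r > 0" "ball a r \<subseteq> W" "inj_on (\<lambda>z. \<pi> (f z)) (ball a r)"
    "\<And>z u. z \<in> ball a r \<Longrightarrow> \<pi> (?D z u) = 0 \<Longrightarrow> u = 0"
    using locally_injective_immersion[OF W, of "\<lambda>z. \<pi> (f z)" "\<lambda>z u. \<pi> (?D z u)"] by metis
  show ?thesis
  proof (rule that[OF r(1,2)])
    fix z z' s assume "z \<in> ball a r" "z' \<in> ball a r" and "f z - f z' = s *\<^sub>R v"
    moreover from this have "\<pi> (f z) = \<pi> (f z')" using \<pi>v[of s] linear_diff[OF lin, of "f z" "f z'"] by simp
    ultimately show "z = z'" using r(3) by (auto dest: inj_onD)
  next
    fix z u s assume "z \<in> ball a r" "?D z u = s *\<^sub>R v"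
    then show "u = 0" using r(4) \<pi>v by metis
  qed
qed


section \<open>Folding along a hyperplane that cuts off the highest point\<close>

lemma frechet_derivative_distance_squared_comp:
  fixes A :: "('a, 'm::finite) chart set" and i :: "'a \<Rightarrow> real ^ 'n" and p :: "'l::finite \<Rightarrow> real ^ 'n"
  assumes X: "smooth_manifold X A" and i: "smooth_map A i" and c: "c \<in> A" "x \<in> chart_dom c"
  shows "frechet_derivative (distance_squared_mapping p \<circ> i \<circ> chart_inv c) (at (chart_map c x)) u =
    (\<chi> j. 2 * ((i x - p j) \<bullet> frechet_derivative (i \<circ> chart_inv c) (at (chart_map c x)) u))"
proof -
  have "(i \<circ> chart_inv c) (chart_map c x) = i x" using chart_inv_chart_map[OF X c] by simp
  then have "(distance_squared_mapping p has_derivative (\<lambda>w. \<chi> j. 2 * ((i x - p j) \<bullet> w)))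
      (at ((i \<circ> chart_inv c) (chart_map c x)))"
    using has_derivative_distance_squared_mapping by metis
  from diff_chain_at[OF smooth_map_chart[OF i c] this] frechet_derivative_at
  have "frechet_derivative (distance_squared_mapping p \<circ> (i \<circ> chart_inv c)) (at (chart_map c x)) =
      (\<lambda>w. \<chi> j. 2 * ((i x - p j) \<bullet> w)) \<circ> frechet_derivative (i \<circ> chart_inv c) (at (chart_map c x))"
    by metis
  then show ?thesis by (simp add: comp_assoc)
qed

lemma smooth_map_distance_squared_comp:
  assumes "smooth_manifold X A" "smooth_map A i"
  shows "smooth_map A (distance_squared_mapping p \<circ> i)"
  unfolding smooth_map_def comp_assoc
  using assms(2) Cinf_on_distance_squared_mapping smooth_manifold_chart(3)[OF assms(1)]
  unfolding smooth_map_def by blast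

lemma codim_image_injective:
  fixes L :: "'b::euclidean_space \<Rightarrow> 'c::euclidean_space"
  assumes "linear L" "inj L" "DIM('b) = DIM('c)"
  shows "codim (L ` S) = codim S"
  using dim_image_eq[OF assms(1), of S] assms(2,3) inj_on_subset unfolding codim_def by (metis subset_UNIV)

text \<open>Points of \<open>X\<close> outside \<open>U\<close> lie below the mirror image of the highest level \<open>m\<close> in the
  hyperplane at height \<open>t\<close>, so a reflected pair of points, and every point on the hyperplane, lies in
  \<open>U\<close>. There the projection along \<open>v\<close> is an injective immersion, and it does not notice the
  reflection. Hence the fold identifies no further points; its derivative has no kernel on a tangent
  space; off the hyperplane it is a linear isomorphism, which preserves codimensions; and on the
  hyperplane fibres are single points, for which the crossing condition is void.\<close>

lemma folded_immersion_with_normal_crossings: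
  fixes A :: "('a, 'm::finite) chart set" and i :: "'a \<Rightarrow> real ^ 'l::finite" and p :: "'l \<Rightarrow> real ^ 'l"
  assumes X: "smooth_manifold X A" and i: "immersion_with_normal_crossings X A i"
    and p: "spans_hyperplane p v t"
    and top: "\<And>q. q \<in> topspace X \<Longrightarrow> v \<bullet> i q \<le> m" and "t < m"
    and low: "\<And>q. q \<in> topspace X - U \<Longrightarrow> v \<bullet> i q < 2 * t - m"
    and proj: "\<And>q q' r. q \<in> U \<Longrightarrow> q' \<in> U \<Longrightarrow> i q - i q' = r *\<^sub>R v \<Longrightarrow> q = q'"
    and transv: "\<And>q r. q \<in> U \<Longrightarrow> q \<in> topspace X \<Longrightarrow>
      r *\<^sub>R v \<in> differential i q ` tangent_space A q \<Longrightarrow> r *\<^sub>R v = 0"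
  shows "immersion_with_normal_crossings X A (distance_squared_mapping p \<circ> i)"
proof -
  let ?D = "distance_squared_mapping p"
  let ?L = "\<lambda>q w. \<chi> j. 2 * ((i q - p j) \<bullet> w)"
  let ?T = "\<lambda>q. differential i q ` tangent_space A q"
  have sm: "smooth_map A i" and imm: "\<And>q. q \<in> topspace X \<Longrightarrow> inj_on (differential i q) (tangent_space A q)"
    and nc: "\<And>y. normal_crossings_at X A i y"
    using i unfolding immersion_with_normal_crossings_def immersion_def by blast+
  have smD: "smooth_map A (?D \<circ> i)" using smooth_map_distance_squared_comp[OF X sm] .
  have linL: "linear (?L q)" for q
    by (rule linearI) (simp_all add: vec_eq_iff inner_add_right algebra_simps)
  have fibre: "i q = i q'" if q: "q \<in> topspace X" "q' \<in> topspace X" and eq: "?D (i q) = ?D (i q')" for q q'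
  proof -
    obtain r where r: "i q - i q' = r *\<^sub>R v" "r = 0 \<or> v \<bullet> i q + v \<bullet> i q' = 2 * t"
      using distance_squared_mapping_fibre[OF p eq] by blast
    from r(2) show ?thesis
    proof
      assume "r = 0" then show ?thesis using r(1) by simp
    next
      assume "v \<bullet> i q + v \<bullet> i q' = 2 * t"
      then have "\<not> v \<bullet> i q < 2 * t - m" "\<not> v \<bullet> i q' < 2 * t - m"
        using top[OF q(1)] top[OF q(2)] by linarith+
      then have "q \<in> U" "q' \<in> U" using low q by blast+
      then show ?thesis using proj r(1) by blast
    qed
  qed
  have onH: "q \<in> U" if "q \<in> topspace X" "v \<bullet> i q = t" for q
    using low[of q] that \<open>t < m\<close> by force
  have tangentD: "differential (?D \<circ> i) q ` tangent_space A q = ?L q ` ?T q" if q: "q \<in> topspace X" for q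
  proof -
    obtain c where c: "c \<in> A" "q \<in> chart_dom c" using X q unfolding smooth_manifold_def by blast
    show ?thesis
      unfolding differential_image_chart[OF X smD c] differential_image_chart[OF X sm c]
        frechet_derivative_distance_squared_comp[OF X sm c, abs_def] by (simp add: image_image)
  qed
  have injL: "inj (?L q)" if "v \<bullet> i q \<noteq> t" for q
    unfolding linear_injective_0[OF linL]
  proof (intro allI impI)
    fix w assume "?L q w = 0"
    then show "w = 0" using distance_squared_mapping_derivative_kernel[OF p] that by (metis scaleR_zero_left)
  qed
  have "inj_on (differential (?D \<circ> i) q) (tangent_space A q)" if q: "q \<in> topspace X" for q
  proof -
    obtain c where c: "c \<in> A" "q \<in> chart_dom c" using X q unfolding smooth_manifold_def by blast
    let ?Di = "frechet_derivative (i \<circ> chart_inv c) (at (chart_map c q))"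
    have linDi: "linear ?Di" using smooth_map_chart[OF sm c] by (rule has_derivative_linear)
    have injDi: "inj ?Di" using imm[OF q] differential_inj_chart[OF X sm c] by blast
    have eq: "frechet_derivative (?D \<circ> i \<circ> chart_inv c) (at (chart_map c q)) = ?L q \<circ> ?Di"
      unfolding comp_def[of "?L q"] by (rule ext) (rule frechet_derivative_distance_squared_comp[OF X sm c])
    have "u = 0" if u: "(?L q \<circ> ?Di) u = 0" for u
    proof -
      obtain r where r: "?Di u = r *\<^sub>R v" "r = 0 \<or> v \<bullet> i q = t"
        using distance_squared_mapping_derivative_kernel[OF p, of "i q" "?Di u"] u by auto
      have "?Di u = 0"
      proof (cases "r = 0")
        case False
        then have "q \<in> U" using r(2) onH[OF q] by blast
        moreover have "r *\<^sub>R v \<in> ?T q"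
          unfolding differential_image_chart[OF X sm c] r(1)[symmetric] by (rule rangeI)
        ultimately show ?thesis using transv q r(1) by simp
      qed (use r in simp)
      then show "u = 0" using injDi linear_injective_0[OF linDi] by blast
    qed
    then show ?thesis
      unfolding differential_inj_chart[OF X smD c] eq
      using linear_injective_0[OF linear_compose[OF linDi linL]] by blast
  qed
  with smD have "immersion X A (?D \<circ> i)" unfolding immersion_def by blast
  moreover have "normal_crossings_at X A (?D \<circ> i) y" for y
  proof (cases "{q \<in> topspace X. (?D \<circ> i) q = y} = {}")
    case True
    then show ?thesis unfolding normal_crossings_at_def True by (simp add: codim_def)
  next
    case False
    then obtain q0 where q0: "q0 \<in> topspace X" "?D (i q0) = y" by auto
    have F: "{q \<in> topspace X. (?D \<circ> i) q = y} = {q \<in> topspace X. i q = i q0}"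
      using fibre[OF _ q0(1)] q0(2) by auto
    have fin: "finite {q \<in> topspace X. i q = i q0}"
      using nc unfolding normal_crossings_at_def by blast
    have "codim (\<Inter>q\<in>S. differential (?D \<circ> i) q ` tangent_space A q) =
        (\<Sum>q\<in>S. codim (differential (?D \<circ> i) q ` tangent_space A q))"
      if S: "S \<subseteq> {q \<in> topspace X. i q = i q0}" for S
    proof (cases "S = {} \<or> (\<exists>q. S = {q})")
      case True
      then show ?thesis by (auto simp: codim_def)
    next
      case False
      then obtain q1 q2 where q: "q1 \<in> S" "q2 \<in> S" "q1 \<noteq> q2" by blast
      \<comment> \<open>A point on the hyperplane has only one preimage, since \<open>i\<close> is injective on \<open>U\<close>.\<close>
      have off: "v \<bullet> i q0 \<noteq> t"
      proof
        assume "v \<bullet> i q0 = t"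
        then have "q1 \<in> U" "q2 \<in> U" using onH q S by auto
        moreover have "i q1 = i q0" "i q2 = i q0" using q S by blast+
        then have "i q1 - i q2 = 0 *\<^sub>R v" by simp
        ultimately show False using proj \<open>q1 \<noteq> q2\<close> by blast
      qed
      have img: "differential (?D \<circ> i) q ` tangent_space A q = ?L q0 ` ?T q" if "q \<in> S" for q
      proof -
        have "q \<in> topspace X" "i q = i q0" using S that by blast+
        then show ?thesis using tangentD[of q] by simp
      qed
      have "(\<Inter>q\<in>S. differential (?D \<circ> i) q ` tangent_space A q) = (\<Inter>q\<in>S. ?L q0 ` ?T q)"
        using img by (intro INF_cong) auto
      also have "\<dots> = ?L q0 ` (\<Inter>q\<in>S. ?T q)"
        using image_INT[OF injL[OF off], of S ?T q1] q(1) by simp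
      finally have "codim (\<Inter>q\<in>S. differential (?D \<circ> i) q ` tangent_space A q) = codim (\<Inter>q\<in>S. ?T q)"
        using codim_image_injective[OF linL injL[OF off]] by simp
      also have "\<dots> = (\<Sum>q\<in>S. codim (?T q))"
        using nc S unfolding normal_crossings_at_def by blast
      also have "\<dots> = (\<Sum>q\<in>S. codim (differential (?D \<circ> i) q ` tangent_space A q))"
        using img codim_image_injective[OF linL injL[OF off]] by (intro sum.cong) simp_all
      finally show ?thesis .
    qed
    with fin show ?thesis unfolding normal_crossings_at_def F by blast
  qed
  ultimately show ?thesis unfolding immersion_with_normal_crossings_def by blast
qed

theorem theorem1p2:
  fixes M :: "'a topology"
    and A :: "('a, 'm::finite) chart set"
    and i :: "'a \<Rightarrow> real ^ 'l::finite"
    and e :: "nat \<Rightarrow> 'l"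
  assumes "closed_manifold M A"
    and "topspace M \<noteq> {}"
    and "CARD('m) + 1 \<le> CARD('l)"
    and "immersion_with_normal_crossings M A i"
    and "bij_betw e {1..CARD('l)} UNIV"
  shows "\<exists>p :: 'l \<Rightarrow> real ^ 'l.
           (\<forall>k\<in>{1..CARD('m) + 1}. p (e k) \<in> i ` topspace M) \<and>
           immersion_with_normal_crossings M A (distance_squared_mapping p \<circ> i)"
proof -
  have X: "smooth_manifold M A" and comp: "compact_space M"
    using assms(1) unfolding closed_manifold_def by blast+
  note i = assms(4)
  have sm: "smooth_map A i" and imm: "\<And>q. q \<in> topspace M \<Longrightarrow> inj_on (differential i q) (tangent_space A q)"
    using i unfolding immersion_with_normal_crossings_def immersion_def by blast+
  have cont: "continuous_map M euclidean i" using smooth_map_continuous[OF X sm] .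
  have cpt: "compact (i ` K)" if "closedin M K" for K
    using image_compactin[OF closedin_compact_space[OF comp that] cont] by simp

  obtain q1 where q1: "q1 \<in> topspace M" using assms(2) by blast
  \<comment> \<open>Height is measured in the direction from a centre \<open>a\<close> to a point of the image farthest from it.
    Any centre different from some point of the image makes that direction nonzero.\<close>
  define a where "a = i q1 + (1 :: real ^ 'l)"
  obtain q0 where q0: "q0 \<in> topspace M" and far: "\<And>q. q \<in> topspace M \<Longrightarrow> dist a (i q) \<le> dist a (i q0)"
    using distance_attains_sup[OF cpt[OF closedin_topspace], of a] assms(2) by auto
  define v where "v = i q0 - a"
  have "a \<noteq> i q1" by (simp add: a_def)
  then have "v \<noteq> 0" using far[OF q1] by (auto simp: v_def dist_le_zero_iff)
  have norm_le: "norm (i q - a) \<le> norm v" if "q \<in> topspace M" for q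
    using far[OF that] by (simp add: v_def dist_norm norm_minus_commute)
  have top: "v \<bullet> i q \<le> v \<bullet> i q0" if "q \<in> topspace M" for q
  proof -
    have "v \<bullet> (i q - a) \<le> norm v * norm (i q - a)" by (rule norm_cauchy_schwarz)
    also have "\<dots> \<le> norm v * norm v" using norm_le[OF that] by (simp add: mult_left_mono)
    also have "\<dots> = v \<bullet> (i q0 - a)" by (simp add: v_def dot_square_norm power2_eq_square)
    finally show ?thesis by (simp add: inner_diff_right)
  qed
  \<comment> \<open>Equality in the Cauchy-Schwarz inequality: the sphere of farthest points touches its tangent
    hyperplane only at \<open>i q0\<close>.\<close>
  have strict: "v \<bullet> i q < v \<bullet> i q0" if q: "q \<in> topspace M" "q \<noteq> q0" for q
  proof (rule ccontr)
    assume "\<not> v \<bullet> i q < v \<bullet> i q0"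
    then have "v \<bullet> (i q - a) \<ge> v \<bullet> v" by (simp add: v_def inner_diff_right)
    moreover have "(norm (i q - a))\<^sup>2 \<le> (norm v)\<^sup>2" using norm_le[OF q(1)] by (simp add: power_mono)
    ultimately have "(i q - a - v) \<bullet> (i q - a - v) \<le> 0"
      by (simp add: power2_norm_eq_inner inner_diff_left[of "i q - a"] inner_diff_right[of _ "i q - a"]
          inner_commute)
    then have "i q - a - v = 0" by (metis inner_gt_zero_iff not_le)
    then have "i q = i q0" by (simp add: v_def)
    then show False using highest_point_preimage_unique[OF X i q0 \<open>v \<noteq> 0\<close> top q(1)] q(2) by blast
  qed

  obtain c where c: "c \<in> A" "q0 \<in> chart_dom c"
    using X q0 unfolding smooth_manifold_def by blast
  let ?W = "chart_map c ` chart_dom c"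
  let ?f = "i \<circ> chart_inv c"
  let ?z0 = "chart_map c q0"
  note W = smooth_manifold_chart(3)[OF X c(1)]
  have z0W: "?z0 \<in> ?W" using c(2) by blast
  have f: "Cinf_on ?f ?W" using sm c(1) unfolding smooth_map_def by blast
  have fz: "?f (chart_map c q) = i q" if "q \<in> chart_dom c" for q
    using chart_inv_chart_map[OF X c(1) that] by simp
  have dom: "chart_dom c \<subseteq> topspace M" using smooth_manifold_chart(1)[OF X c(1)] .
  have injf: "inj (frechet_derivative ?f (at ?z0))"
    using imm[OF q0] differential_inj_chart[OF X sm c] by blast
  have rangef: "range (frechet_derivative ?f (at ?z0)) \<subseteq> {w. v \<bullet> w = 0}"
    using tangent_image_at_highest_point[OF X sm q0 top] differential_image_chart[OF X sm c] by simp

  obtain r where r: "r > 0" "ball ?z0 r \<subseteq> ?W"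
    "\<And>z z' s. z \<in> ball ?z0 r \<Longrightarrow> z' \<in> ball ?z0 r \<Longrightarrow> ?f z - ?f z' = s *\<^sub>R v \<Longrightarrow> z = z'"
    "\<And>z u s. z \<in> ball ?z0 r \<Longrightarrow> frechet_derivative ?f (at z) u = s *\<^sub>R v \<Longrightarrow> u = 0"
    using locally_injective_projection[OF W z0W f injf \<open>v \<noteq> 0\<close> rangef] by blast
  define U where "U = {q \<in> chart_dom c. chart_map c q \<in> ball ?z0 r}"
  have "openin M U" unfolding U_def by (rule openin_chart_preimage[OF X c(1) open_ball])
  have "q0 \<in> U" using c(2) r(1) by (simp add: U_def)
  have "\<exists>t\<^sub>2 < v \<bullet> i q0. \<forall>q\<in>topspace M - U. v \<bullet> i q \<le> t\<^sub>2"
  proof (cases "topspace M - U = {}")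
    case True
    have "v \<bullet> i q0 - 1 < v \<bullet> i q0" by simp
    then show ?thesis using True by blast
  next
    case False
    have "compact (i ` (topspace M - U))" using cpt \<open>openin M U\<close> by blast
    moreover have "continuous_on (i ` (topspace M - U)) (\<lambda>x. v \<bullet> x)" by (intro continuous_intros)
    ultimately obtain q2 where "q2 \<in> topspace M - U"
      "\<forall>q\<in>topspace M - U. v \<bullet> i q \<le> v \<bullet> i q2"
      using continuous_attains_sup[of "i ` (topspace M - U)" "\<lambda>x. v \<bullet> x"] False by auto
    then show ?thesis using strict \<open>q0 \<in> U\<close> by blast
  qed
  then obtain t\<^sub>2 where t2: "t\<^sub>2 < v \<bullet> i q0" "\<And>q. q \<in> topspace M - U \<Longrightarrow> v \<bullet> i q \<le> t\<^sub>2" by blast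

  have peak: "v \<bullet> ?f z < v \<bullet> ?f ?z0" if z: "z \<in> ?W" "z \<noteq> ?z0" for z
  proof -
    obtain q where q: "q \<in> chart_dom c" "z = chart_map c q" using z(1) by blast
    then show ?thesis using strict[of q] z(2) dom fz[OF q(1)] fz[OF c(2)] by auto
  qed
  obtain t\<^sub>1 where t1: "t\<^sub>1 < v \<bullet> i q0"
    "\<And>t. t\<^sub>1 < t \<Longrightarrow> t < v \<bullet> i q0 \<Longrightarrow> \<exists>b :: 'm option \<Rightarrow> real ^ 'l.
       range b \<subseteq> ?f ` ?W \<and> (\<forall>j. v \<bullet> b j = t) \<and> inj b \<and> \<not> affine_dependent (range b)"
    using simplex_in_level_near_peak[OF W z0W Cinf_onD(3)[OF f] Cinf_onD(1)[OF f z0W] injf peak]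
    unfolding fz[OF c(2)] by blast
  \<comment> \<open>Above the midpoint of \<open>t\<^sub>2\<close> and the maximal height, the mirror image of the top level lies
    above everything outside \<open>U\<close>.\<close>
  obtain t where t: "max t\<^sub>1 ((t\<^sub>2 + v \<bullet> i q0) / 2) < t" "t < v \<bullet> i q0"
    using dense[of "max t\<^sub>1 ((t\<^sub>2 + v \<bullet> i q0) / 2)" "v \<bullet> i q0"] t1(1) t2(1) by auto
  obtain b :: "'m option \<Rightarrow> real ^ 'l" where b: "range b \<subseteq> ?f ` ?W" "\<And>j. v \<bullet> b j = t"
    "inj b" "\<not> affine_dependent (range b)"
    using t1(2)[of t] t by auto
  have bM: "b j \<in> i ` topspace M" for j
  proof -
    have "b j \<in> ?f ` ?W" using b(1) by blast
    then obtain q where "q \<in> chart_dom c" "b j = ?f (chart_map c q)" by blast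
    then show ?thesis using fz dom by auto
  qed

  have "card (UNIV :: 'm option set) = card {1..CARD('m) + 1}" by simp
  then obtain \<beta> where \<beta>: "bij_betw \<beta> (UNIV :: 'm option set) {1..CARD('m) + 1}"
    using finite_same_card_bij[of "UNIV :: 'm option set" "{1..CARD('m) + 1}"] by auto
  have "inj (e \<circ> \<beta>)"
  proof (rule comp_inj_on)
    show "inj \<beta>" using \<beta> by (rule bij_betw_imp_inj_on)
    have "range \<beta> \<subseteq> {1..CARD('l)}" using \<beta> assms(3) by (auto simp: bij_betw_def)
    then show "inj_on e (range \<beta>)" using assms(5) inj_on_subset unfolding bij_betw_def by blast
  qed
  then obtain p :: "'l \<Rightarrow> real ^ 'l" where p: "spans_hyperplane p v t" "\<And>j. p ((e \<circ> \<beta>) j) = b j"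
    using spans_hyperplane_extend[OF \<open>v \<noteq> 0\<close> b(2,3,4), of "e \<circ> \<beta>"] by auto
  have "p (e k) \<in> i ` topspace M" if k: "k \<in> {1..CARD('m) + 1}" for k
  proof -
    obtain j where "k = \<beta> j" using \<beta> k unfolding bij_betw_def by blast
    then show ?thesis using p(2)[of j] bM[of j] by simp
  qed
  moreover have "immersion_with_normal_crossings M A (distance_squared_mapping p \<circ> i)"
  proof (rule folded_immersion_with_normal_crossings[OF X i p(1) top t(2)])
    show "v \<bullet> i q < 2 * t - v \<bullet> i q0" if "q \<in> topspace M - U" for q
      using t2(2)[OF that] t(1) by (simp add: field_simps)
    show "q = q'" if q: "q \<in> U" "q' \<in> U" and eq: "i q - i q' = s *\<^sub>R v" for q q' s
    proof -
      have "chart_map c q = chart_map c q'"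
        using q eq fz by (intro r(3)) (auto simp: U_def)
      then show ?thesis
        using q smooth_manifold_chart(2)[OF X c(1)] by (auto simp: U_def dest: inj_onD)
    qed
    show "s *\<^sub>R v = 0" if q: "q \<in> U" and s: "s *\<^sub>R v \<in> differential i q ` tangent_space A q" for q s
    proof -
      have qc: "q \<in> chart_dom c" "chart_map c q \<in> ball ?z0 r" using q by (auto simp: U_def)
      obtain u where u: "s *\<^sub>R v = frechet_derivative ?f (at (chart_map c q)) u"
        using s unfolding differential_image_chart[OF X sm c(1) qc(1)] by blast
      have "u = 0" using r(4)[OF qc(2)] u by metis
      moreover have "linear (frechet_derivative ?f (at (chart_map c q)))"
        using smooth_map_chart[OF sm c(1) qc(1)] by (rule has_derivative_linear)
      ultimately show ?thesis using u linear_0 by metis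
    qed
  qed
  ultimately show ?thesis by blast
qed

end
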